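(* Let $\sigma$ be a conformal gradient field on $M=S^n$, and let $p,q\in\mathbb R$. Then $\sigma$ is a $(p,q)$-harmonic section of $TM$ if and only if $n\ge 3$ and $$p=n+1,\qquad q=2-n,\qquad \|\sigma\|_\infty=1/\sqrt{-q}.$$
   Context: $M=S^n\subset\mathbb R^{n+1}$ ($n\ge1$) is the unit sphere with the induced Riemannian metric $g$; the bundle is $TM$ with fibre metric $\langle\,,\rangle=g$ and Levi-Civita connection $\nabla$. A conformal gradient field on $S^n$ is a vector field $\sigma=\nabla\lambda$ (gradient of $\lambda$), where $\lambda\colon S^n\to\mathbb R$, $\lambda(x)=a\cdot x$, for some $a\in\mathbb R^{n+1}\smallsetminus\{0\}$. $\|\sigma\|_\infty=\sup_{x\in M}|\sigma(x)|$ (which equals $|a|$). For a vector field $\sigma$ on $M$ put $F=\tfrac12|\sigma|^2\colon M\to\mathbb R$, let $\nabla F$ be its gradient, and $|\nabla\sigma|^2=\sum_i|\nabla_{E_i}\sigma|^2$ for a local orthonormal tangent frame $\{E_i\}$. For $p,q\in\mathbb R$ define a symmetric 2-tensor on the total space $TM$ (with projection $\pi$) by $h_{p,q}(A,B)=g(d\pi(A),d\pi(B))+(1+|e|^2)^{-p}\big(\langle KA,KB\rangle+q\langle KA,e\rangle\langle KB,e\rangle\big)$ for $A,B\in T_e(TM)$, where $K$ is the connection map of $\nabla$. The vertical $(p,q)$-energy of $\sigma$ (half the integral of the $h_{p,q}$-square norm of the vertical part of $d\sigma$) is $$E^v_{p,q}(\sigma)=\frac12\int_M\frac{1}{(1+|\sigma|^2)^p}\big(|\nabla\sigma|^2+q|\nabla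 F|^2\big)\,\mathrm{vol}(g).$$ $\sigma$ is a $(p,q)$-harmonic section of $TM$ if $\frac{d}{dt}\big|_{t=0}E^v_{p,q}(\sigma_t)=0$ for every smooth variation $\sigma_t$ of $\sigma_0=\sigma$ through vector fields. *)

theory Defs
  imports "HOL-Analysis.Analysis"
begin

text \<open>
  The sphere \<open>S\<^sup>n\<close> is \<open>sphere 0 1\<close> in a Euclidean space \<open>'a\<close> of dimension \<open>n + 1\<close>.
  Functions, vector fields and variations are total functions on \<open>'a\<close> of which only the values
  on \<open>sphere 0 1\<close> are relevant.
\<close>

subsection \<open>Smooth maps on subsets of Euclidean spaces\<close>

primrec Ck_on :: "nat \<Rightarrow> ('a::euclidean_space \<Rightarrow> 'b::euclidean_space) \<Rightarrow> 'a set \<Rightarrow> bool" where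
  "Ck_on 0 f U \<longleftrightarrow> continuous_on U f"
| "Ck_on (Suc k) f U \<longleftrightarrow> (\<forall>x\<in>U. f differentiable (at x)) \<and>
     (\<forall>v. Ck_on k (\<lambda>x. frechet_derivative f (at x) v) U)"

text \<open>A map on an arbitrary subset is smooth if it has local smooth extensions; on a submanifold
  this is smoothness in the sense of manifolds.\<close>

definition smooth_map_on :: "'a::euclidean_space set \<Rightarrow> ('a \<Rightarrow> 'b::euclidean_space) \<Rightarrow> bool" where
  "smooth_map_on A f \<longleftrightarrow>
     (\<forall>x\<in>A. \<exists>U g. open U \<and> x \<in> U \<and> (\<forall>k. Ck_on k g U) \<and> (\<forall>y\<in>A \<inter> U. g y = f y))"

subsection \<open>Riemannian geometry of the unit sphere\<close>

definition tangent_space :: "'a::euclidean_space \<Rightarrow> 'a set" where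
  "tangent_space x = {v. x \<bullet> v = 0}"

definition smooth_vector_field :: "('a::euclidean_space \<Rightarrow> 'a) \<Rightarrow> bool" where
  "smooth_vector_field X \<longleftrightarrow>
     smooth_map_on (sphere 0 1) X \<and> (\<forall>x\<in>sphere 0 1. X x \<in> tangent_space x)"

text \<open>The differential at \<open>x\<close> of a map on the sphere, in the direction of a tangent vector \<open>v\<close>.
  The map is extended off the sphere by making it constant along rays; by
  \<open>sphere_deriv_extension\<close> below, any other differentiable extension gives the same value.\<close>

definition sphere_deriv ::
    "('a::euclidean_space \<Rightarrow> 'b::euclidean_space) \<Rightarrow> 'a \<Rightarrow> 'a \<Rightarrow> 'b" where
  "sphere_deriv f x v = frechet_derivative (\<lambda>y. f (y /\<^sub>R norm y)) (at x) v"

definition sphere_grad :: "('a::euclidean_space \<Rightarrow> real) \<Rightarrow> 'a \<Rightarrow> 'a" where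
  "sphere_grad f x =
     (THE w. w \<in> tangent_space x \<and> (\<forall>v\<in>tangent_space x. w \<bullet> v = sphere_deriv f x v))"

text \<open>\<open>covd X x v\<close> is \<open>\<nabla>\<^sub>v X\<close> at \<open>x\<close>. The Levi-Civita connection of a metric induced from a
  Euclidean space is the tangential part of the Euclidean derivative.\<close>

definition covd :: "('a::euclidean_space \<Rightarrow> 'a) \<Rightarrow> 'a \<Rightarrow> 'a \<Rightarrow> 'a" where
  "covd X x v = sphere_deriv X x v - (sphere_deriv X x v \<bullet> x) *\<^sub>R x"

definition is_orthonormal_frame :: "'a::euclidean_space \<Rightarrow> 'a set \<Rightarrow> bool" where
  "is_orthonormal_frame x B \<longleftrightarrow>
     pairwise orthogonal B \<and> (\<forall>e\<in>B. norm e = 1) \<and> span B = tangent_space x"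

definition orthonormal_frame :: "'a::euclidean_space \<Rightarrow> 'a set" where
  "orthonormal_frame x = (SOME B. is_orthonormal_frame x B)"

definition covd_norm_sq :: "('a::euclidean_space \<Rightarrow> 'a) \<Rightarrow> 'a \<Rightarrow> real" where
  "covd_norm_sq X x = (\<Sum>e\<in>orthonormal_frame x. (norm (covd X x e))\<^sup>2)"

text \<open>The Riemannian volume measure. In polar coordinates Lebesgue measure on \<open>'a\<close> is
  \<open>r\<^sup>n dr \<otimes> vol\<close>, so the volume of \<open>A\<close> is \<open>n + 1 = DIM('a)\<close> times the Lebesgue measure of the part
  of the unit ball that projects radially into \<open>A\<close>.\<close>

definition sphere_vol :: "'a::euclidean_space measure" where
  "sphere_vol = scale_measure (of_nat DIM('a))
     (distr (restrict_space lborel (cball 0 1 - {0})) (restrict_space borel (sphere 0 1))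
        (\<lambda>x. x /\<^sub>R norm x))"

subsection \<open>Conformal gradient fields and harmonic sections\<close>

definition conformal_gradient_field :: "('a::euclidean_space \<Rightarrow> 'a) \<Rightarrow> bool" where
  "conformal_gradient_field \<sigma> \<longleftrightarrow>
     (\<exists>a. a \<noteq> 0 \<and> (\<forall>x\<in>sphere 0 1. \<sigma> x = sphere_grad (\<lambda>y. a \<bullet> y) x))"

definition sup_norm :: "('a::euclidean_space \<Rightarrow> 'a) \<Rightarrow> real" where
  "sup_norm \<sigma> = (SUP x\<in>sphere 0 1. norm (\<sigma> x))"

definition vertical_energy :: "real \<Rightarrow> real \<Rightarrow> ('a::euclidean_space \<Rightarrow> 'a) \<Rightarrow> real" where
  "vertical_energy p q \<sigma> = 1/2 * (\<integral>x. 1 / (1 + (norm (\<sigma> x))\<^sup>2) powr p *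
     (covd_norm_sq \<sigma> x + q * (norm (sphere_grad (\<lambda>y. 1/2 * (norm (\<sigma> y))\<^sup>2) x))\<^sup>2) \<partial>sphere_vol)"

definition smooth_variation ::
    "('a::euclidean_space \<Rightarrow> 'a) \<Rightarrow> real \<Rightarrow> (real \<Rightarrow> 'a \<Rightarrow> 'a) \<Rightarrow> bool" where
  "smooth_variation \<sigma> \<epsilon> s \<longleftrightarrow> \<epsilon> > 0 \<and>
     smooth_map_on ({-\<epsilon><..<\<epsilon>} \<times> sphere 0 1) (\<lambda>(t, x). s t x) \<and>
     (\<forall>t\<in>{-\<epsilon><..<\<epsilon>}. \<forall>x\<in>sphere 0 1. s t x \<in> tangent_space x) \<and>
     (\<forall>x\<in>sphere 0 1. s 0 x = \<sigma> x)"

definition harmonic_section :: "real \<Rightarrow> real \<Rightarrow> ('a::euclidean_space \<Rightarrow> 'a) \<Rightarrow> bool" where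
  "harmonic_section p q \<sigma> \<longleftrightarrow> smooth_vector_field \<sigma> \<and>
     (\<forall>\<epsilon> s. smooth_variation \<sigma> \<epsilon> s \<longrightarrow>
        ((\<lambda>t. vertical_energy p q (s t)) has_real_derivative 0) (at 0))"

subsection \<open>Well-definedness\<close>

lemma is_orthonormal_frame_orthonormal_frame:
  "is_orthonormal_frame x (orthonormal_frame x)"
proof -
  have "subspace (tangent_space x)"
    by (simp add: tangent_space_def subspace_hyperplane)
  then obtain B where "pairwise orthogonal B" "\<And>e. e \<in> B \<Longrightarrow> norm e = 1" "span B = tangent_space x"
    by (rule orthonormal_basis_subspace) metis
  then have "is_orthonormal_frame x B"
    by (auto simp: is_orthonormal_frame_def)
  then show ?thesis
    unfolding orthonormal_frame_def by (rule someI)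
qed

lemma sphere_deriv_extension:
  fixes f :: "'a::euclidean_space \<Rightarrow> 'b::euclidean_space"
  assumes x: "x \<in> sphere 0 1" and v: "v \<in> tangent_space x"
    and g: "(g has_derivative g') (at x)"
    and U: "open U" "x \<in> U" "\<And>y. y \<in> sphere 0 1 \<inter> U \<Longrightarrow> g y = f y"
  shows "sphere_deriv f x v = g' v"
proof -
  define P where "P = (\<lambda>y::'a. y /\<^sub>R norm y)"
  have nx: "norm x = 1" and x0: "x \<noteq> 0" using x by auto
  have "(norm has_derivative (\<lambda>h. x \<bullet> h)) (at x)"
    using has_derivative_norm[OF x0] nx by (simp add: sgn_div_norm inner_commute)
  then have P: "(P has_derivative (\<lambda>h. h - (x \<bullet> h) *\<^sub>R x)) (at x)"
  proof -
    assume *: "(norm has_derivative (\<lambda>h. x \<bullet> h)) (at x)"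
    have "((\<lambda>y. inverse (norm y)) has_derivative (\<lambda>h. - (x \<bullet> h))) (at x)"
      using Deriv.has_derivative_inverse[OF _ *] nx by simp
    from has_derivative_scaleR[OF this has_derivative_ident] show ?thesis
      by (simp add: P_def nx)
  qed
  have "P x = x" using nx by (simp add: P_def)
  with g have "((\<lambda>y. g (P y)) has_derivative (\<lambda>h. g' (h - (x \<bullet> h) *\<^sub>R x))) (at x)"
    using has_derivative_compose[OF P, of g g'] by simp
  moreover have "\<forall>\<^sub>F y in at x. g (P y) = f (P y)"
  proof -
    have "(P \<longlongrightarrow> x) (at x)"
      using has_derivative_continuous[OF P] \<open>P x = x\<close> by (simp add: continuous_at)
    then have "\<forall>\<^sub>F y in at x. P y \<in> U"
      using U(1,2) by (rule topological_tendstoD)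
    moreover have "\<forall>\<^sub>F y in at x. y \<noteq> 0"
      by (rule tendsto_imp_eventually_ne[OF tendsto_ident_at x0])
    ultimately show ?thesis
    proof eventually_elim
      case (elim y)
      then have "P y \<in> sphere 0 1" by (simp add: P_def)
      with elim show ?case using U(3) by blast
    qed
  qed
  moreover have "g (P x) = f (P x)"
    using U x \<open>P x = x\<close> by auto
  ultimately have "((\<lambda>y. f (P y)) has_derivative (\<lambda>h. g' (h - (x \<bullet> h) *\<^sub>R x))) (at x)"
    by (rule has_derivative_transform_eventually) simp_all
  then have "frechet_derivative (\<lambda>y. f (P y)) (at x) = (\<lambda>h. g' (h - (x \<bullet> h) *\<^sub>R x))"
    by (rule frechet_derivative_at[symmetric])
  then show ?thesis
    using v by (simp add: sphere_deriv_def P_def tangent_space_def)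
qed

lemma sphere_grad:
  fixes f :: "'a::euclidean_space \<Rightarrow> real"
  assumes x: "x \<in> sphere 0 1" and d: "(\<lambda>y. f (y /\<^sub>R norm y)) differentiable (at x)"
  shows "sphere_grad f x \<in> tangent_space x"
    and "v \<in> tangent_space x \<Longrightarrow> sphere_grad f x \<bullet> v = sphere_deriv f x v"
proof -
  define D where "D = sphere_deriv f x"
  have "linear D"
    using d unfolding D_def sphere_deriv_def[abs_def] by (rule linear_frechet_derivative)
  then have adj: "adjoint D 1 \<bullet> v = D v" for v
    using adjoint_clauses(2)[of D 1 v] by simp
  define w where "w = adjoint D 1 - (x \<bullet> adjoint D 1) *\<^sub>R x"
  have "x \<bullet> x = 1" using x by (simp add: dot_square_norm)
  then have w: "w \<in> tangent_space x" "\<forall>v\<in>tangent_space x. w \<bullet> v = D v"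
    by (auto simp: w_def tangent_space_def inner_diff_left inner_diff_right adj)
  moreover have "u = w" if "u \<in> tangent_space x" "\<forall>v\<in>tangent_space x. u \<bullet> v = D v" for u
  proof -
    have "u - w \<in> tangent_space x"
      using that w by (simp add: tangent_space_def inner_diff_right)
    then have "(u - w) \<bullet> (u - w) = 0"
      using that(2) w(2) by (simp add: inner_diff_left)
    then show ?thesis by simp
  qed
  ultimately have "sphere_grad f x = w"
    unfolding sphere_grad_def D_def[symmetric] by (intro the_equality) blast+
  with w show "sphere_grad f x \<in> tangent_space x"
    and "v \<in> tangent_space x \<Longrightarrow> sphere_grad f x \<bullet> v = sphere_deriv f x v"
    unfolding D_def by simp_all
qed

lemma emeasure_sphere_vol:
  fixes A :: "'a::euclidean_space set"
  assumes "A \<subseteq> sphere 0 1" "A \<in> sets borel"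
  shows "emeasure sphere_vol A =
    of_nat DIM('a) * emeasure lborel {x \<in> cball 0 1 - {0}. x /\<^sub>R norm x \<in> A}"
proof -
  let ?M = "restrict_space lborel (cball 0 1 - {0 :: 'a})"
  have "(\<lambda>x. x /\<^sub>R norm x) \<in> ?M \<rightarrow>\<^sub>M restrict_space borel (sphere (0::'a) 1)"
    by (intro measurable_restrict_space2 measurable_restrict_space1) (auto simp: space_restrict_space)
  moreover have "A \<in> sets (restrict_space borel (sphere 0 1))"
    using assms by (simp add: sets_restrict_space_iff)
  moreover have "(\<lambda>x. x /\<^sub>R norm x) -` A \<inter> space ?M = {x \<in> cball 0 1 - {0}. x /\<^sub>R norm x \<in> A}"
    by (auto simp: space_restrict_space)
  moreover have "emeasure ?M {x \<in> cball 0 1 - {0}. x /\<^sub>R norm x \<in> A} =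
      emeasure lborel {x \<in> cball 0 1 - {0}. x /\<^sub>R norm x \<in> A}"
    by (rule emeasure_restrict_space) auto
  ultimately show ?thesis
    unfolding sphere_vol_def by (simp only: emeasure_scale_measure emeasure_distr)
qed

end

theory Submission
  imports Defs
begin

text \<open>
  Write \<open>v\<close> for the gradient of the height function \<open>l(x) = a \<bullet> x\<close>, so that \<open>|v|\<^sup>2 = c - l\<^sup>2\<close> with
  \<open>c = |a|\<^sup>2\<close>, and let \<open>u = 1 + |v|\<^sup>2\<close>. For a variation of \<open>v\<close> with velocity \<open>w\<close>, adding the divergence of
  the tangent field \<open>u powr (-p) * l * (w + q (v \<bullet> w) v)\<close> to the derivative of the energy density removes
  every derivative of \<open>w\<close>: what is left is \<open>u powr (-p-1) * G(l\<^sup>2) * (v \<bullet> w)\<close> for a quadratic polynomial \<open>G\<close>.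
  Choosing \<open>w = G(l\<^sup>2) v\<close> shows that \<open>v\<close> is harmonic iff \<open>G = 0\<close> on \<open>[0, c)\<close>, the values of \<open>l\<^sup>2\<close> where
  \<open>v \<noteq> 0\<close>; comparing coefficients gives \<open>q c = -1\<close>, \<open>p = n + 1\<close> and \<open>q = 2 - n\<close>.
\<close>

section \<open>Integration over the sphere\<close>

text \<open>The compensating field is dictated by the conformal equation: for tangent
  \<open>h\<close>, the tangential part of the derivative of \<open>v\<close> along \<open>h\<close>
  is \<open>- l h\<close>. Hence derivatives of \<open>w\<close> enter the varied density only
  through the divergence of \<open>w\<close> and, weighted by \<open>q\<close>, the
  \<open>v\<close>-component of the derivative of \<open>w\<close> along \<open>v\<close>, both with
  the factor \<open>- 2 u powr (- p) l\<close>. The divergence of the compensating field contains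
  the same terms with \<open>u powr (- p) l\<close>, so twice that divergence cancels them. Maps on
  the sphere are differentiated through \<open>f (sgn y)\<close>, which is constant along rays. Such
  derivatives annihilate the radius, so traces over a tangent frame become sums over
  \<open>Basis\<close>. The divergence theorem is reduced to the flat one, which follows from
  translation invariance. A variation is smooth only through local extensions in time and space;
  symmetry of their second derivatives lets the time derivative pass through
  \<open>sphere_deriv\<close>. The bound \<open>n \<ge> 3\<close> has no separate source:
  \<open>q c = -1\<close> forces \<open>q < 0\<close>, and \<open>q = 2 - n\<close>.\<close>

lemma has_real_derivative_lebesgue_integral:
  fixes f f' :: "real \<Rightarrow> 'a \<Rightarrow> real"
  assumes \<delta>: "\<delta> > 0"
    and int: "\<And>t. \<bar>t\<bar> < \<delta> \<Longrightarrow> integrable M (f t)"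
    and der: "\<And>t x. \<bar>t\<bar> < \<delta> \<Longrightarrow> x \<in> space M \<Longrightarrow> ((\<lambda>\<tau>. f \<tau> x) has_real_derivative f' t x) (at t)"
    and bound: "\<And>t x. \<bar>t\<bar> < \<delta> \<Longrightarrow> x \<in> space M \<Longrightarrow> \<bar>f' t x\<bar> \<le> w x"
    and w: "integrable M w"
  shows "integrable M (f' 0)"
    and "((\<lambda>t. \<integral>x. f t x \<partial>M) has_real_derivative (\<integral>x. f' 0 x \<partial>M)) (at 0)"
proof -
  have quotient_lim: "(\<lambda>n. (f (Y n) x - f 0 x) / Y n) \<longlonglongrightarrow> f' 0 x"
    if "x \<in> space M" "filterlim Y (at 0) sequentially" for Y x
  proof -
    have "((\<lambda>h. (f h x - f 0 x) / h) \<longlongrightarrow> f' 0 x) (at 0)"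
      using der[of 0 x] \<delta> that by (simp add: DERIV_def)
    from filterlim_compose[OF this that(2)] show ?thesis .
  qed
  have quotient_meas: "(\<lambda>x. (f t x - f 0 x) / t) \<in> borel_measurable M" if "\<bar>t\<bar> < \<delta>" for t
    using int[OF that] int[of 0] \<delta> by (auto intro!: borel_measurable_divide borel_measurable_diff)
  \<comment> \<open>Measurability of \<open>f' 0\<close> is inherited from difference quotients
    along a null sequence of steps; the offset 2 keeps the step strictly below
    \<open>\<delta>\<close> already at \<open>n = 0\<close>.\<close>
  have meas: "f' 0 \<in> borel_measurable M"
  proof (rule borel_measurable_LIMSEQ_real)
    let ?Y = "\<lambda>n. \<delta> / real (n + 2)"
    have "?Y \<longlonglongrightarrow> 0"
      by (rule LIMSEQ_ignore_initial_segment) (rule lim_const_over_n)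
    then have "filterlim ?Y (at 0) sequentially"
      using \<delta> by (auto simp: filterlim_at)
    from quotient_lim[OF _ this]
    show "(\<lambda>n. (f (?Y n) x - f 0 x) / ?Y n) \<longlonglongrightarrow> f' 0 x" if "x \<in> space M" for x
      using that .
    have "\<delta> * 1 < \<delta> * real (n + 2)" for n
      using \<delta> by (intro mult_strict_left_mono) auto
    then show "(\<lambda>x. (f (?Y n) x - f 0 x) / ?Y n) \<in> borel_measurable M" for n
      using \<delta> by (intro quotient_meas) (simp add: divide_less_eq)
  qed
  show "integrable M (f' 0)"
    using w meas by (rule Bochner_Integration.integrable_bound) (use bound[of 0] \<delta> in force)
  have "((\<lambda>h. ((\<integral>x. f h x \<partial>M) - (\<integral>x. f 0 x \<partial>M)) / h) \<longlongrightarrow> (\<integral>x. f' 0 x \<partial>M)) (at 0)"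
    unfolding tendsto_at_iff_sequentially
  proof (intro allI impI)
    fix X :: "nat \<Rightarrow> real"
    assume X: "\<forall>i. X i \<in> UNIV - {0}" "X \<longlonglongrightarrow> 0"
    from X(2) \<delta> obtain N where "\<And>n. n \<ge> N \<Longrightarrow> \<bar>X n\<bar> < \<delta>"
      by (metis LIMSEQ_D diff_zero real_norm_def)
    define Y where "Y = (\<lambda>n. X (n + N))"
    have Y: "\<bar>Y n\<bar> < \<delta>" "Y n \<noteq> 0" for n
      using \<open>\<And>n. n \<ge> N \<Longrightarrow> \<bar>X n\<bar> < \<delta>\<close> X(1) by (auto simp: Y_def)
    have Y0: "filterlim Y (at 0) sequentially"
      using X(2) Y(2) by (simp add: filterlim_at Y_def LIMSEQ_ignore_initial_segment)
    \<comment> \<open>The mean value inequality carries the bound on the derivative over to all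
      difference quotients, which makes \<open>w\<close> the majorant for dominated
      convergence.\<close>
    have le: "\<bar>(f (Y n) x - f 0 x) / Y n\<bar> \<le> w x" if x: "x \<in> space M" for x n
    proof -
      have "norm (f (Y n) x - f 0 x) \<le> w x * norm (Y n - 0)"
      proof (rule field_differentiable_bound[of "{-\<delta><..<\<delta>}" "\<lambda>\<tau>. f \<tau> x" "\<lambda>t. f' t x"])
        fix z assume z: "z \<in> {-\<delta><..<\<delta>}"
        then show "((\<lambda>\<tau>. f \<tau> x) has_real_derivative f' z x) (at z within {-\<delta><..<\<delta>})"
          using der x by (auto intro: has_field_derivative_at_within)
        show "norm (f' z x) \<le> w x"
          using z bound[OF _ x, of z] by auto
      qed (use Y(1)[of n] \<delta> in auto)
      then show ?thesis using Y by (simp add: divide_le_eq)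
    qed
    have "(\<lambda>n. \<integral>x. (f (Y n) x - f 0 x) / Y n \<partial>M) \<longlonglongrightarrow> (\<integral>x. f' 0 x \<partial>M)"
    proof (rule integral_dominated_convergence[where w = w])
    qed (use w quotient_lim[OF _ Y0] quotient_meas[OF Y(1)] meas le in auto)
    moreover have "(\<integral>x. (f (Y n) x - f 0 x) / Y n \<partial>M) =
        ((\<integral>x. f (Y n) x \<partial>M) - (\<integral>x. f 0 x \<partial>M)) / Y n" for n
      by (subst Bochner_Integration.integral_diff[symmetric])
        (use int[OF Y(1)] int[of 0] \<delta> in auto)
    ultimately have "(\<lambda>n. ((\<integral>x. f (X (n + N)) x \<partial>M) - (\<integral>x. f 0 x \<partial>M)) / X (n + N)) \<longlonglongrightarrow> (\<integral>x. f' 0 x \<partial>M)"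
      by (simp only: Y_def)
    then show "((\<lambda>h. ((\<integral>x. f h x \<partial>M) - (\<integral>x. f 0 x \<partial>M)) / h) \<circ> X) \<longlonglongrightarrow> (\<integral>x. f' 0 x \<partial>M)"
      unfolding o_def by (rule LIMSEQ_offset)
  qed
  then show "((\<lambda>t. \<integral>x. f t x \<partial>M) has_real_derivative (\<integral>x. f' 0 x \<partial>M)) (at 0)" by (simp add: DERIV_def)
qed

section \<open>The volume measure of the sphere and its integral\<close>

lemma integral_scale_measure:
  fixes f :: "'a \<Rightarrow> real"
  assumes "f \<in> borel_measurable M" "c \<ge> 0"
  shows "integral\<^sup>L (scale_measure (ennreal c) M) f = c * integral\<^sup>L M f"
proof -
  have "scale_measure (ennreal c) M = density M (\<lambda>_. ennreal c)"
    by (rule measure_eqI) (auto simp: emeasure_density nn_integral_cmult_indicator)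
  then show ?thesis
    using assms by (simp add: integral_density)
qed

lemma radial_projection_measurable:
  "(\<lambda>x. x /\<^sub>R norm x) \<in> restrict_space lborel (cball 0 1 - {0}) \<rightarrow>\<^sub>M
     restrict_space borel (sphere (0::'a::euclidean_space) 1)"
  by (intro measurable_restrict_space2 measurable_restrict_space1) (auto simp: space_restrict_space)

lemma space_sphere_vol [simp]: "space sphere_vol = sphere (0::'a::euclidean_space) 1"
  by (simp add: sphere_vol_def space_scale_measure space_restrict_space)

lemma sets_sphere_vol: "sets sphere_vol = sets (restrict_space borel (sphere (0::'a::euclidean_space) 1))"
  by (simp add: sphere_vol_def)

lemma borel_measurable_sphere_vol:
  fixes f :: "'a::euclidean_space \<Rightarrow> real"
  assumes "continuous_on (sphere 0 1) f"
  shows "f \<in> borel_measurable sphere_vol"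
  using borel_measurable_continuous_on_restrict[OF assms]
  by (simp add: sphere_vol_def cong: measurable_cong_sets)

lemma finite_measure_sphere_vol: "finite_measure (sphere_vol :: 'a::euclidean_space measure)"
proof
  have "emeasure lborel {x \<in> cball 0 1 - {0::'a}. x /\<^sub>R norm x \<in> sphere 0 1} \<le> emeasure lborel (cball 0 1 :: 'a set)"
    by (rule emeasure_mono) auto
  also have "\<dots> < \<infinity>" by (intro emeasure_bounded_finite) auto
  finally show "emeasure sphere_vol (space sphere_vol :: 'a set) \<noteq> \<infinity>"
    by (simp add: emeasure_sphere_vol ennreal_mult_eq_top_iff)
qed

lemma integrable_sphere_vol:
  fixes f :: "'a::euclidean_space \<Rightarrow> real"
  assumes f: "continuous_on (sphere 0 1) f"
  shows "integrable sphere_vol f"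
proof -
  interpret finite_measure "sphere_vol :: 'a measure" by (rule finite_measure_sphere_vol)
  have "bounded (f ` sphere 0 1)"
    using f by (intro compact_imp_bounded compact_continuous_image) auto
  then obtain B where "\<And>x. x \<in> sphere 0 1 \<Longrightarrow> norm (f x) \<le> B"
    by (fastforce simp: bounded_iff)
  then show ?thesis
    by (intro integrable_const_bound[of _ B] AE_I2 borel_measurable_sphere_vol[OF f]) simp
qed

text \<open>This is the only bridge from integrals over the sphere to Lebesgue integrals: the
  integrand is extended constantly along rays, and the constant compensates the radial integral of
  \<open>r ^ (DIM('a) - 1)\<close> over \<open>[0, 1]\<close>.\<close>

lemma integral_sphere_vol:
  fixes f :: "'a::euclidean_space \<Rightarrow> real"
  assumes f: "continuous_on (sphere 0 1) f"
  shows "(\<integral>x. f x \<partial>sphere_vol) =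
    DIM('a) * (\<integral>x. indicator (cball 0 1 - {0}) x * f (x /\<^sub>R norm x) \<partial>lborel)"
proof -
  have meas: "f \<in> borel_measurable (restrict_space borel (sphere 0 1))"
    using f by (rule borel_measurable_continuous_on_restrict)
  have "(\<integral>x. f x \<partial>sphere_vol) = DIM('a) * (\<integral>x. f x \<partial>distr (restrict_space lborel (cball 0 1 - {0}))
      (restrict_space borel (sphere 0 1)) (\<lambda>x. x /\<^sub>R norm x))"
    using meas unfolding sphere_vol_def
    by (subst ennreal_of_nat_eq_real_of_nat, subst integral_scale_measure) auto
  also have "\<dots> = DIM('a) * (\<integral>x. f (x /\<^sub>R norm x) \<partial>restrict_space lborel (cball 0 1 - {0}))"
    by (subst integral_distr[OF radial_projection_measurable meas]) simp
  finally show ?thesis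
    by (subst (asm) integral_restrict_space) auto
qed

text \<open>The directions with positive value span a cone whose part inside the open ball is open.
  If \<open>f x > 0\<close>, it contains \<open>x / 2\<close> and so is not negligible; but a
  vanishing integral makes \<open>f\<close> zero almost everywhere and the cone a null set.\<close>

lemma integral_sphere_vol_eq_0:
  fixes f :: "'a::euclidean_space \<Rightarrow> real"
  assumes f: "continuous_on (sphere 0 1) f" and nonneg: "\<And>x. x \<in> sphere 0 1 \<Longrightarrow> 0 \<le> f x"
    and int: "(\<integral>x. f x \<partial>sphere_vol) = 0" and x: "x \<in> sphere 0 1"
  shows "f x = 0"
proof (rule ccontr)
  assume "f x \<noteq> 0"
  let ?P = "\<lambda>y::'a. y /\<^sub>R norm y"
  define U where "U = {y \<in> ball 0 1 - {0}. f (?P y) \<in> {0<..}}"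
  have cont: "continuous_on (ball 0 1 - {0}) (\<lambda>y. f (?P y))"
    by (rule continuous_on_compose2[OF f]) (auto intro!: continuous_intros, metis left_inverse norm_eq_zero)
  have "open (ball 0 1 - {0::'a})"
    by (intro open_delete) simp
  then have "open U"
    using continuous_open_preimage[OF cont, of "{0<..}"] by (simp add: U_def vimage_def Int_def conj_ac)
  moreover have "(1/2) *\<^sub>R x \<in> U"
    using x nonneg[OF x] \<open>f x \<noteq> 0\<close> by (auto simp: U_def)
  ultimately have "\<not> negligible U"
    using open_not_negligible by blast
  moreover have "negligible U"
  proof -
    have "AE y in sphere_vol. 0 \<le> f y"
      using nonneg by (intro AE_I2) simp
    then have "AE y in sphere_vol. f y = 0"
      using integral_nonneg_eq_0_iff_AE[OF integrable_sphere_vol[OF f]] int by simp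
    moreover have N: "{y \<in> space sphere_vol. f y \<noteq> 0} \<in> sets sphere_vol"
      using borel_measurable_sphere_vol[OF f] by measurable
    ultimately have "emeasure sphere_vol {y\<in>sphere 0 1. f y \<noteq> 0} = 0"
      by (subst (asm) AE_iff_measurable[OF _ refl]) simp_all
    moreover have B: "{y\<in>sphere 0 1. f y \<noteq> 0} \<in> sets borel"
      using N unfolding space_sphere_vol sets_sphere_vol by (subst (asm) sets_restrict_space_iff) auto
    ultimately have "emeasure lborel {y \<in> cball 0 1 - {0::'a}. ?P y \<in> {y\<in>sphere 0 1. f y \<noteq> 0}} = 0"
      by (subst (asm) emeasure_sphere_vol) auto
    moreover have "{y \<in> cball 0 1 - {0::'a}. ?P y \<in> {y\<in>sphere 0 1. f y \<noteq> 0}} \<in> sets lborel"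
    proof -
      have "?P -` {y\<in>sphere 0 1. f y \<noteq> 0} \<inter> space lborel \<in> sets lborel"
        using B by measurable
      then have "(cball 0 1 - {0}) \<inter> (?P -` {y\<in>sphere 0 1. f y \<noteq> 0} \<inter> space lborel) \<in> sets lborel"
        by auto
      also have "(cball 0 1 - {0}) \<inter> (?P -` {y\<in>sphere 0 1. f y \<noteq> 0} \<inter> space lborel) =
        {y \<in> cball 0 1 - {0::'a}. ?P y \<in> {y\<in>sphere 0 1. f y \<noteq> 0}}" by auto
      finally show ?thesis .
    qed
    ultimately have "{y \<in> cball 0 1 - {0::'a}. ?P y \<in> {y\<in>sphere 0 1. f y \<noteq> 0}} \<in> null_sets lborel"
      by (rule null_setsI)
    then have "negligible {y \<in> cball 0 1 - {0::'a}. ?P y \<in> {y\<in>sphere 0 1. f y \<noteq> 0}}"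
      unfolding negligible_iff_null_sets by (rule null_sets_completionI)
    then show ?thesis
      by (rule negligible_subset) (auto simp: U_def)
  qed
  ultimately show False by simp
qed

section \<open>The divergence theorem on the sphere\<close>

lemma has_derivative_sgn:
  fixes y :: "'a::euclidean_space"
  assumes "y \<noteq> 0"
  shows "(sgn has_derivative (\<lambda>h. (h - (sgn y \<bullet> h) *\<^sub>R sgn y) /\<^sub>R norm y)) (at y)"
proof -
  have n: "(norm has_derivative (\<lambda>h. sgn y \<bullet> h)) (at y)"
    using has_derivative_norm[OF assms] by (simp add: inner_commute)
  have "((\<lambda>y. inverse (norm y)) has_derivative
      (\<lambda>h. - (inverse (norm y) * (sgn y \<bullet> h) * inverse (norm y)))) (at y)"
    using Deriv.has_derivative_inverse[OF _ n] assms by simp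
  from has_derivative_scaleR[OF this has_derivative_ident] show ?thesis
    unfolding sgn_div_norm[abs_def]
    by (rule has_derivative_eq_rhs) (auto simp: sgn_div_norm algebra_simps)
qed

lemma sphere_deriv_sgn: "sphere_deriv f x = frechet_derivative (\<lambda>y. f (sgn y)) (at x)"
  by (simp add: sphere_deriv_def[abs_def] sgn_div_norm)

text \<open>A function of \<open>sgn y\<close> is homogeneous of degree 0, so its derivative is
  homogeneous of degree -1 and is determined by the derivative on the unit sphere.\<close>

lemma has_derivative_comp_sgn:
  fixes f :: "'a::euclidean_space \<Rightarrow> 'b::euclidean_space"
  assumes f: "((\<lambda>y. f (sgn y)) has_derivative D) (at (sgn y))" and y: "y \<noteq> 0"
  shows "((\<lambda>y. f (sgn y)) has_derivative (\<lambda>h. D h /\<^sub>R norm y)) (at y)"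
proof -
  have "sgn (z /\<^sub>R norm y) = sgn z" for z :: 'a
    using y by (simp add: sgn_scaleR)
  moreover have "((\<lambda>z. f (sgn (z /\<^sub>R norm y))) has_derivative (\<lambda>h. D (h /\<^sub>R norm y))) (at y)"
    by (rule has_derivative_compose[where f = "\<lambda>z. z /\<^sub>R norm y" and g = "\<lambda>y. f (sgn y)"])
      (use f in \<open>auto intro!: derivative_eq_intros simp: sgn_div_norm\<close>)
  moreover have "D (h /\<^sub>R norm y) = D h /\<^sub>R norm y" for h
    using linear_scale[OF has_derivative_linear[OF f]] .
  ultimately show ?thesis by simp
qed

text \<open>Squaring smooths the kink of \<open>max 0\<close>, which gives cutoffs that vanish
  beyond a point and still have a continuous derivative.\<close>

lemma has_real_derivative_max_0_square:
  "((\<lambda>z::real. (max 0 z)\<^sup>2) has_real_derivative 2 * max 0 z) (at z)"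
proof -
  consider "z < 0" | "z = 0" | "z > 0" by linarith
  then show ?thesis
  proof cases
    case 1
    have "\<forall>\<^sub>F w in nhds z. (max 0 w)\<^sup>2 = 0"
      using eventually_nhds_in_open[of "{..<0}" z] 1 by (auto elim!: eventually_mono simp: max_def)
    from DERIV_cong_ev[OF refl this refl] show ?thesis
      using 1 by simp
  next
    case 2
    have "((\<lambda>h::real. (max 0 h)\<^sup>2 / h) \<longlongrightarrow> 0) (at 0)"
    proof (rule Lim_null_comparison)
      show "\<forall>\<^sub>F h::real in at 0. norm ((max 0 h)\<^sup>2 / h) \<le> \<bar>h\<bar>"
        by (auto simp: max_def power2_eq_square intro!: always_eventually)
      show "((\<lambda>h::real. \<bar>h\<bar>) \<longlongrightarrow> 0) (at 0)"
        by (rule tendsto_rabs_zero) simp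
    qed
    then show ?thesis using 2 by (simp add: DERIV_def)
  next
    case 3
    have "\<forall>\<^sub>F w in nhds z. (max 0 w)\<^sup>2 = w\<^sup>2"
      using eventually_nhds_in_open[of "{0<..}" z] 3 by (auto elim!: eventually_mono simp: max_def)
    from DERIV_cong_ev[OF refl this refl] show ?thesis
      using 3 DERIV_power[OF DERIV_ident, of 2 z] by simp
  qed
qed

text \<open>By translation invariance of Lebesgue measure the integral of
  \<open>g (x + t *\<^sub>R b)\<close> does not depend on \<open>t\<close>; differentiating under
  the integral at \<open>t = 0\<close> gives the claim.\<close>

lemma integral_directional_derivative_eq_0:
  fixes g :: "'a::euclidean_space \<Rightarrow> real"
  assumes g: "\<And>y. (g has_derivative g' y) (at y)"
    and supp: "\<And>y. norm y > 1 \<Longrightarrow> g y = 0" "\<And>y. norm y > 1 \<Longrightarrow> g' y b = 0"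
    and bound: "\<And>y. norm y \<le> 1 \<Longrightarrow> \<bar>g' y b\<bar> \<le> C"
  shows "integrable lborel (\<lambda>y. g' y b)" and "(\<integral>y. g' y b \<partial>lborel) = 0"
proof -
  \<comment> \<open>A ball that contains the supports of all translates by
    \<open>t *\<^sub>R b\<close> with \<open>\<bar>t\<bar> < 1\<close>, so one indicator function
    dominates every derivative.\<close>
  define R where "R = 1 + norm b"
  define f where "f = (\<lambda>t x. g (x + t *\<^sub>R b))"
  define f' where "f' = (\<lambda>t x. g' (x + t *\<^sub>R b) b)"
  have C: "C \<ge> 0" using bound[of 0] by (auto intro: order_trans[rotated])
  have near: "norm x \<le> R" if "norm (x + t *\<^sub>R b) \<le> 1" "\<bar>t\<bar> < 1" for x t
  proof -
    have "norm x \<le> norm (x + t *\<^sub>R b) + norm (t *\<^sub>R b)"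
      using norm_triangle_ineq4[of "x + t *\<^sub>R b" "t *\<^sub>R b"] by simp
    also have "norm (t *\<^sub>R b) \<le> 1 * norm b"
      unfolding norm_scaleR real_norm_def using that(2) by (intro mult_right_mono) auto
    finally show ?thesis using that(1) by (simp add: R_def)
  qed
  have cont: "continuous_on UNIV g"
    using g by (meson continuous_at_imp_continuous_on has_derivative_continuous)
  have int: "integrable lborel (f t)" if t: "\<bar>t\<bar> < 1" for t
  proof -
    have "integrable lborel (\<lambda>x. indicator (cball 0 R) x *\<^sub>R f t x)"
      unfolding f_def
      by (rule borel_integrable_compact)
        (auto intro!: continuous_intros continuous_on_compose2[OF cont])
    moreover have "indicator (cball 0 R) x *\<^sub>R f t x = f t x" for x
    proof (cases "norm x \<le> R")
      case False
      then have "norm (x + t *\<^sub>R b) > 1" using near[OF _ t] by (meson not_le)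
      then show ?thesis by (simp add: f_def supp)
    qed simp
    ultimately show ?thesis by (simp only:)
  qed
  have der: "((\<lambda>\<tau>. f \<tau> x) has_real_derivative f' t x) (at t)" for t x
  proof -
    have "((\<lambda>\<tau>. g (x + \<tau> *\<^sub>R b)) has_derivative (\<lambda>h. g' (x + t *\<^sub>R b) (h *\<^sub>R b))) (at t)"
      by (rule has_derivative_compose[where g = g])
        (auto intro!: derivative_eq_intros g)
    moreover have "g' (x + t *\<^sub>R b) (h *\<^sub>R b) = g' (x + t *\<^sub>R b) b * h" for h
      using linear_scale[OF has_derivative_linear[OF g], of "x + t *\<^sub>R b" h b] by (simp only: real_scaleR_def mult.commute)
    ultimately show ?thesis
      by (simp add: f_def f'_def has_field_derivative_def)
  qed
  have le: "\<bar>f' t x\<bar> \<le> C * indicator (cball 0 R) x" if t: "\<bar>t\<bar> < 1" for t x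
  proof (cases "norm (x + t *\<^sub>R b) \<le> 1")
    case True
    then show ?thesis using bound[OF True] near[OF True t] by (simp add: f'_def)
  next
    case False
    then show ?thesis using C by (simp add: f'_def supp)
  qed
  have w: "integrable lborel (\<lambda>x::'a. C * indicator (cball 0 R) x)"
    using emeasure_bounded_finite[of "cball (0::'a) R"]
    by (intro integrable_mult_right integrable_real_indicator) auto
  have *: "integrable lborel (f' 0)"
    "((\<lambda>t. \<integral>x. f t x \<partial>lborel) has_real_derivative (\<integral>x. f' 0 x \<partial>lborel)) (at 0)"
    using has_real_derivative_lebesgue_integral[of 1 lborel f f' "\<lambda>x. C * indicator (cball 0 R) x"]
      int der le w by auto
  have "(\<integral>x. f t x \<partial>lborel) = (\<integral>x. g x \<partial>lborel)" for t
  proof -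
    have "(\<integral>x. g x \<partial>lborel) = (\<integral>x. g x \<partial>distr lborel borel ((+) (t *\<^sub>R b)))"
      by (simp add: lborel_distr_plus)
    also have "\<dots> = (\<integral>x. g (t *\<^sub>R b + x) \<partial>lborel)"
      by (rule integral_distr) (auto intro!: borel_measurable_continuous_onI cont)
    finally show ?thesis by (simp add: f_def add.commute)
  qed
  then have "(\<integral>x. f' 0 x \<partial>lborel) = 0"
    using *(2) DERIV_unique[OF _ DERIV_const] by fastforce
  with *(1) show "integrable lborel (\<lambda>y. g' y b)" "(\<integral>y. g' y b \<partial>lborel) = 0"
    by (simp_all add: f'_def)
qed

text \<open>The field \<open>\<phi>(|y|\<^sup>2) |y| W(y/|y|)\<close> is differentiable with compact support, so its divergence
  integrates to 0. As \<open>W\<close> is tangent, the radial factors contribute nothing to the divergence.\<close>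

lemma integral_cutoff_sphere_divergence:
  fixes W :: "'a::euclidean_space \<Rightarrow> 'a"
  assumes W: "\<And>x. x \<in> sphere 0 1 \<Longrightarrow> ((\<lambda>y. W (sgn y)) has_derivative W' x) (at x)"
    and cont: "\<And>v. continuous_on (sphere 0 1) (\<lambda>x. W' x v)"
    and tangent: "\<And>x. x \<in> sphere 0 1 \<Longrightarrow> W x \<in> tangent_space x"
    and \<phi>: "\<And>r. (\<phi> has_real_derivative \<phi>' r) (at r)" "continuous_on UNIV \<phi>'"
    and supp: "\<phi> 0 = 0" "\<And>r. r \<ge> 1 \<Longrightarrow> \<phi> r = 0" "\<And>r. r \<ge> 1 \<Longrightarrow> \<phi>' r = 0"
  shows "(\<integral>y. \<phi> ((norm y)\<^sup>2) * (\<Sum>b\<in>Basis. W' (sgn y) b \<bullet> b) \<partial>lborel) = 0"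
proof -
  \<comment> \<open>With the factor \<open>norm y\<close> the field is homogeneous of degree 1, so
    its derivative \<open>K' y\<close> depends on \<open>sgn y\<close> alone and no power of the
    radius is left in front of the trace of \<open>W'\<close>.\<close>
  define K where "K = (\<lambda>y. norm y *\<^sub>R W (sgn y))"
  define g where "g = (\<lambda>y. \<phi> ((norm y)\<^sup>2) *\<^sub>R K y)"
  define K' where "K' = (\<lambda>y h. (sgn y \<bullet> h) *\<^sub>R W (sgn y) + W' (sgn y) h)"
  define g' where "g' = (\<lambda>y h. if y = 0 then 0 else
    (\<phi>' ((norm y)\<^sup>2) * (2 * (y \<bullet> h))) *\<^sub>R K y + \<phi> ((norm y)\<^sup>2) *\<^sub>R K' y h)"
  have sgn: "sgn y \<in> sphere 0 1" if "y \<noteq> 0" for y :: 'a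
    using that by (simp add: norm_sgn)
  have contW: "continuous_on (sphere 0 1) W"
  proof (rule continuous_on_eq)
    show "continuous_on (sphere 0 1) (\<lambda>y. W (sgn y))"
      using W by (meson continuous_at_imp_continuous_on has_derivative_continuous)
  qed (simp add: sgn_div_norm)
  have bdd: "\<exists>C. \<forall>x\<in>sphere 0 1. norm (F x) \<le> C" if "continuous_on (sphere 0 1) F" for F :: "'a \<Rightarrow> 'a"
    using compact_imp_bounded[OF compact_continuous_image[OF that compact_sphere]]
    by (auto simp: bounded_iff)
  obtain B where B: "\<And>x. x \<in> sphere 0 1 \<Longrightarrow> norm (W x) \<le> B"
    using bdd[OF contW] by blast
  have "continuous_on UNIV \<phi>"
    using \<phi>(1) by (meson continuous_at_imp_continuous_on DERIV_isCont)
  then have "bounded (\<phi> ` {0..1})" "bounded (\<phi>' ` {0..1})"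
    using \<phi>(2) by (auto intro!: compact_imp_bounded compact_continuous_image elim: continuous_on_subset)
  then obtain M M' where M: "\<And>r. 0 \<le> r \<Longrightarrow> r \<le> 1 \<Longrightarrow> \<bar>\<phi> r\<bar> \<le> M"
      "\<And>r. 0 \<le> r \<Longrightarrow> r \<le> 1 \<Longrightarrow> \<bar>\<phi>' r\<bar> \<le> M'"
    unfolding bounded_iff by (metis atLeastAtMost_iff image_eqI real_norm_def)
  have normK: "norm (K y) \<le> norm y * B" for y
    using B[OF sgn, of y] by (cases "y = 0") (auto simp: K_def intro: mult_left_mono)
  have der: "(g has_derivative g' y) (at y)" for y
  proof (cases "y = 0")
    case True
    \<comment> \<open>\<open>sgn\<close> is discontinuous at the origin, so the chain rule does not
      apply there. Instead \<open>norm (K h) \<le> norm h * B\<close> and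
      \<open>\<phi> 0 = 0\<close> make \<open>g\<close> differentiable with derivative 0.\<close>
    have "((\<lambda>h. norm (g h) / norm h) \<longlongrightarrow> 0) (at 0)"
    proof (rule Lim_null_comparison)
      have "norm (g h) / norm h \<le> \<bar>\<phi> ((norm h)\<^sup>2)\<bar> * B" for h
        using mult_left_mono[OF normK[of h], of "\<bar>\<phi> ((norm h)\<^sup>2)\<bar>"] B[OF sgn, of h]
        by (cases "h = 0") (auto simp: g_def divide_le_eq mult_ac supp)
      then show "\<forall>\<^sub>F h in at 0. norm (norm (g h) / norm h) \<le> \<bar>\<phi> ((norm h)\<^sup>2)\<bar> * B"
        by (simp add: always_eventually)
      have "((\<lambda>h::'a. \<bar>\<phi> ((norm h)\<^sup>2)\<bar> * B) \<longlongrightarrow> \<bar>\<phi> ((norm (0::'a))\<^sup>2)\<bar> * B) (at 0)"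
        using \<open>continuous_on UNIV \<phi>\<close>
        by (intro tendsto_intros isCont_tendsto_compose[of _ \<phi>])
          (auto simp: continuous_on_eq_continuous_at)
      then show "((\<lambda>h::'a. \<bar>\<phi> ((norm h)\<^sup>2)\<bar> * B) \<longlongrightarrow> 0) (at 0)"
        by (simp add: supp)
    qed
    then have "(g has_derivative (\<lambda>h. 0)) (at 0)"
      by (simp add: has_derivative_at g_def supp)
    then show ?thesis using True by (simp add: g'_def)
  next
    case False
    have n: "(norm has_derivative (\<lambda>h. sgn y \<bullet> h)) (at y)"
      using has_derivative_norm[OF False] by (simp add: inner_commute)
    have "(K has_derivative (\<lambda>h. norm y *\<^sub>R (W' (sgn y) h /\<^sub>R norm y) + (sgn y \<bullet> h) *\<^sub>R W (sgn y))) (at y)"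
      unfolding K_def
      by (rule has_derivative_scaleR[OF n has_derivative_comp_sgn[OF W[OF sgn[OF False]] False]])
    then have K: "(K has_derivative K' y) (at y)"
      by (rule has_derivative_eq_rhs) (use False in \<open>auto simp: K'_def add.commute\<close>)
    have "((\<lambda>y::'a. y \<bullet> y) has_derivative (\<lambda>h. 2 * (y \<bullet> h))) (at y)"
      by (auto intro!: derivative_eq_intros simp: inner_commute)
    then have n2: "((\<lambda>y. (norm y)\<^sup>2) has_derivative (\<lambda>h. 2 * (y \<bullet> h))) (at y)"
      by (simp add: power2_norm_eq_inner)
    have "((\<lambda>y. \<phi> ((norm y)\<^sup>2)) has_derivative (\<lambda>h. \<phi>' ((norm y)\<^sup>2) * (2 * (y \<bullet> h)))) (at y)"
      using has_derivative_compose[OF n2 \<phi>(1)[unfolded has_field_derivative_def]] .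
    from has_derivative_scaleR[OF this K] show ?thesis
      unfolding g_def by (rule has_derivative_eq_rhs) (use False in \<open>auto simp: g'_def add.commute\<close>)
  qed
  have *: "integrable lborel (\<lambda>y. g' y b \<bullet> b) \<and> (\<integral>y. g' y b \<bullet> b \<partial>lborel) = 0" if b: "b \<in> Basis" for b
  proof -
    obtain B' where B': "\<And>x. x \<in> sphere 0 1 \<Longrightarrow> norm (W' x b) \<le> B'"
      using bdd[OF cont] by blast
    have nb: "norm b = 1" using b by simp
    have le: "\<bar>g' y b \<bullet> b\<bar> \<le> M' * 2 * B + M * (B + B')" if y: "norm y \<le> 1" for y
    proof (cases "y = 0")
      case True
      have "B \<ge> 0" "B' \<ge> 0"
        using nb order_trans[OF norm_ge_zero B, of b] order_trans[OF norm_ge_zero B', of b] by simp_all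
      moreover have "M \<ge> 0" "M' \<ge> 0"
        using M[of 0] by linarith+
      ultimately have "0 \<le> M' * 2 * B + M * (B + B')"
        by simp
      then show ?thesis using True by (simp add: g'_def)
    next
      case False
      have y2: "(norm y)\<^sup>2 \<le> 1" using y by (simp add: power_le_one)
      have Bs: "norm (W (sgn y)) \<le> B" "norm (W' (sgn y) b) \<le> B'"
        using B B' sgn[OF False] by auto
      have "\<bar>g' y b \<bullet> b\<bar> \<le> norm (g' y b)"
        using Cauchy_Schwarz_ineq2[of "g' y b" b] nb by simp
      also have "\<dots> \<le> \<bar>\<phi>' ((norm y)\<^sup>2)\<bar> * (2 * \<bar>y \<bullet> b\<bar>) * norm (K y) + \<bar>\<phi> ((norm y)\<^sup>2)\<bar> * norm (K' y b)"
        using False norm_triangle_ineq by (auto simp: g'_def abs_mult intro!: norm_triangle_le)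
      also have "\<dots> \<le> M' * (2 * 1) * B + M * (B + B')"
      proof (intro add_mono mult_mono)
        show "\<bar>y \<bullet> b\<bar> \<le> 1" using Cauchy_Schwarz_ineq2[of y b] nb y by simp
        show "norm (K y) \<le> B"
          using normK[of y] mult_right_mono[OF y, of B] Bs(1) norm_ge_zero[of "W (sgn y)"]
          by linarith
        have "norm (K' y b) \<le> \<bar>sgn y \<bullet> b\<bar> * norm (W (sgn y)) + norm (W' (sgn y) b)"
          unfolding K'_def by (rule norm_triangle_le) simp
        also have "\<bar>sgn y \<bullet> b\<bar> * norm (W (sgn y)) \<le> 1 * B"
          using Cauchy_Schwarz_ineq2[of "sgn y" b] nb False Bs(1)
          by (intro mult_mono) (auto simp: norm_sgn)
        finally show "norm (K' y b) \<le> B + B'" using Bs(2) by simp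
      qed (use M[OF _ y2] in \<open>auto intro: order_trans[OF abs_ge_zero]\<close>)
      finally show ?thesis by simp
    qed
    have "((\<lambda>y. g y \<bullet> b) has_derivative (\<lambda>h. g' y h \<bullet> b)) (at y)" for y
      using der by (rule has_derivative_inner_left)
    moreover have "g y \<bullet> b = 0" "g' y b \<bullet> b = 0" if "norm y > 1" for y
    proof -
      have "(norm y)\<^sup>2 \<ge> 1" using that by (simp add: one_le_power)
      then show "g y \<bullet> b = 0" "g' y b \<bullet> b = 0" by (simp_all add: g_def g'_def supp)
    qed
    ultimately show ?thesis
      using integral_directional_derivative_eq_0[where g = "\<lambda>y. g y \<bullet> b" and g' = "\<lambda>y h. g' y h \<bullet> b" and b = b] le
      by blast
  qed
  have trace: "(\<Sum>b\<in>Basis. g' y b \<bullet> b) = \<phi> ((norm y)\<^sup>2) * (\<Sum>b\<in>Basis. W' (sgn y) b \<bullet> b)" for y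
  proof (cases "y = 0")
    case False
    have "sgn y \<bullet> W (sgn y) = 0"
      using tangent[OF sgn[OF False]] by (simp add: tangent_space_def)
    moreover have "y = norm y *\<^sub>R sgn y" using False by (simp add: sgn_div_norm)
    ultimately have "y \<bullet> W (sgn y) = 0" by (metis inner_scaleR_left mult_zero_right)
    have 1: "(\<Sum>b\<in>Basis. (y \<bullet> b) * (K y \<bullet> b)) = 0"
      unfolding euclidean_inner[symmetric] K_def using \<open>y \<bullet> W (sgn y) = 0\<close> by simp
    have 2: "(\<Sum>b\<in>Basis. (sgn y \<bullet> b) * (W (sgn y) \<bullet> b)) = 0"
      unfolding euclidean_inner[symmetric] by fact
    have "(\<Sum>b\<in>Basis. g' y b \<bullet> b) = 2 * \<phi>' ((norm y)\<^sup>2) * (\<Sum>b\<in>Basis. (y \<bullet> b) * (K y \<bullet> b))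
      + \<phi> ((norm y)\<^sup>2) * ((\<Sum>b\<in>Basis. (sgn y \<bullet> b) * (W (sgn y) \<bullet> b)) + (\<Sum>b\<in>Basis. W' (sgn y) b \<bullet> b))"
      unfolding sum_distrib_left sum.distrib[symmetric] using False
      by (intro sum.cong) (auto simp: g'_def K'_def algebra_simps)
    then show ?thesis unfolding 1 2 by simp
  qed (simp add: g'_def supp)
  have "(\<integral>y. (\<Sum>b\<in>Basis. g' y b \<bullet> b) \<partial>lborel) = (\<Sum>b\<in>Basis. \<integral>y. g' y b \<bullet> b \<partial>lborel)"
    using * by (intro Bochner_Integration.integral_sum) auto
  with * show ?thesis by (simp add: trace)
qed

text \<open>The cutoff version holds for a sequence of cutoffs that tends to 1 on the punctured open
  ball and is 0 outside. Dominated convergence gives a vanishing integral of the ray-constant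
  divergence over the ball, which is a multiple of the integral over the sphere. Since
  \<open>W' x\<close> kills \<open>x\<close>, the full trace of \<open>W'\<close> is the divergence
  along the sphere.\<close>

theorem sphere_divergence:
  fixes W :: "'a::euclidean_space \<Rightarrow> 'a"
  assumes W: "\<And>x. x \<in> sphere 0 1 \<Longrightarrow> ((\<lambda>y. W (sgn y)) has_derivative W' x) (at x)"
    and cont: "\<And>v. continuous_on (sphere 0 1) (\<lambda>x. W' x v)"
    and tangent: "\<And>x. x \<in> sphere 0 1 \<Longrightarrow> W x \<in> tangent_space x"
  shows "(\<integral>x. (\<Sum>b\<in>Basis. W' x b \<bullet> b) \<partial>sphere_vol) = 0"
proof -
  define h where "h = (\<lambda>x. \<Sum>b\<in>Basis. W' x b \<bullet> b)"
  \<comment> \<open>The first factor vanishes with its derivative for \<open>r \<ge> 1\<close>, the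
    second vanishes at \<open>r = 0\<close>, and both tend to 1 for
    \<open>0 < r < 1\<close>.\<close>
  define \<phi> where "\<phi> = (\<lambda>n r::real. (max 0 (1 - r ^ Suc n))\<^sup>2 * (1 - (1 - r) ^ Suc n))"
  define \<phi>' where "\<phi>' = (\<lambda>n r::real. 2 * max 0 (1 - r ^ Suc n) * - (real (Suc n) * r ^ n) * (1 - (1 - r) ^ Suc n)
     + (max 0 (1 - r ^ Suc n))\<^sup>2 * (real (Suc n) * (1 - r) ^ n))"
  have cont_h: "continuous_on (sphere 0 1) h"
    unfolding h_def by (intro continuous_intros cont)
  have der: "(\<phi> n has_real_derivative \<phi>' n r) (at r)" for n r
  proof -
    have "((\<lambda>r. (max 0 (1 - r ^ Suc n))\<^sup>2) has_real_derivative
        2 * max 0 (1 - r ^ Suc n) * - (real (Suc n) * r ^ n)) (at r)"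
      by (rule DERIV_chain2[OF has_real_derivative_max_0_square])
        (rule derivative_eq_intros refl | simp del: power_Suc)+
    moreover have "((\<lambda>r. 1 - (1 - r) ^ Suc n) has_real_derivative real (Suc n) * (1 - r) ^ n) (at r)"
      by (rule derivative_eq_intros refl | simp del: power_Suc)+
    ultimately show ?thesis
      unfolding \<phi>_def \<phi>'_def by (rule DERIV_mult'[THEN DERIV_cong]) (simp add: algebra_simps)
  qed
  have zero: "(\<integral>y. \<phi> n ((norm y)\<^sup>2) * h (sgn y) \<partial>lborel) = 0" for n
    unfolding h_def
  proof (rule integral_cutoff_sphere_divergence[OF W cont tangent der])
    show "continuous_on UNIV (\<phi>' n)"
      unfolding \<phi>'_def by (intro continuous_intros)
    have "max 0 (1 - r ^ Suc n) = 0" if "r \<ge> 1" for r :: real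
      using one_le_power[OF that, of "Suc n"] by simp
    then show "\<phi> n r = 0" "\<phi>' n r = 0" if "r \<ge> 1" for r
      using that by (auto simp: \<phi>_def \<phi>'_def)
  qed (auto simp: \<phi>_def)
  have range: "\<bar>\<phi> n r\<bar> \<le> 1" if "0 \<le> r" "r \<le> 1" for n r
  proof -
    have "0 \<le> 1 - r ^ Suc n" "1 - r ^ Suc n \<le> 1" "0 \<le> 1 - (1 - r) ^ Suc n" "1 - (1 - r) ^ Suc n \<le> 1"
      using that power_le_one[of r "Suc n"] power_le_one[of "1 - r" "Suc n"] by auto
    then show ?thesis
      by (auto simp: \<phi>_def abs_mult power_le_one intro!: mult_le_one)
  qed
  have lim: "(\<lambda>n. \<phi> n r) \<longlonglongrightarrow> 1" if "0 < r" "r < 1" for r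
  proof -
    have "(\<lambda>n. r ^ Suc n) \<longlonglongrightarrow> 0" "(\<lambda>n. (1 - r) ^ Suc n) \<longlonglongrightarrow> 0"
      using that by (auto intro!: LIMSEQ_Suc LIMSEQ_power_zero)
    then have "(\<lambda>n. \<phi> n r) \<longlonglongrightarrow> (max 0 (1 - 0))\<^sup>2 * (1 - 0)"
      unfolding \<phi>_def by (intro tendsto_intros)
    then show ?thesis by simp
  qed
  obtain C where C: "\<And>x. x \<in> sphere 0 1 \<Longrightarrow> \<bar>h x\<bar> \<le> C"
    using compact_imp_bounded[OF compact_continuous_image[OF cont_h compact_sphere]]
    by (fastforce simp: bounded_iff)
  have sgn: "sgn y \<in> sphere 0 1" if "y \<noteq> 0" for y :: 'a
    using that by (simp add: norm_sgn)
  have zero': "\<phi> n r = 0" if "r \<ge> 1" for n r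
    using one_le_power[OF that, of "Suc n"] by (simp add: \<phi>_def)
  \<comment> \<open>\<open>h\<close> is continuous only on the sphere, which
    \<open>sgn 0 = 0\<close> misses. Masking the origin changes nothing in the products below,
    because each \<open>\<phi> n\<close> is 0 there.\<close>
  have meas': "(\<lambda>y. indicator (-{0}) y * h (sgn y)) \<in> borel_measurable lborel"
  proof -
    have "continuous_on (-{0}) (\<lambda>y. h (sgn y))"
      by (rule continuous_on_compose2[OF cont_h]) (auto simp: norm_sgn split: if_split_asm intro!: continuous_on_sgn continuous_on_id)
    then show ?thesis
      using borel_measurable_continuous_on_indicator[of "-{0}" "\<lambda>y. h (sgn y)"] by simp
  qed
  have "(\<lambda>n. \<integral>y. \<phi> n ((norm y)\<^sup>2) * h (sgn y) \<partial>lborel) \<longlonglongrightarrow>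
      (\<integral>y. indicator (cball 0 1 - {0}) y * h (sgn y) \<partial>lborel)"
  proof (rule integral_dominated_convergence[where w = "\<lambda>y. C * indicator (cball 0 1) y"])
    have eq: "\<phi> n ((norm y)\<^sup>2) * h (sgn y) = \<phi> n ((norm y)\<^sup>2) * (indicator (-{0}) y * h (sgn y))" for n y
      by (cases "y = 0") (auto simp: \<phi>_def)
    have "continuous_on UNIV (\<phi> n)" for n
      unfolding \<phi>_def by (intro continuous_intros)
    then show "(\<lambda>y. \<phi> n ((norm y)\<^sup>2) * h (sgn y)) \<in> borel_measurable lborel" for n
      unfolding eq
      by (intro borel_measurable_times[OF _ meas'] borel_measurable_continuous_on[of "\<phi> n"]) auto
    have eq: "indicator (cball 0 1 - {0}) y * h (sgn y) =
        indicator (cball 0 1) y * (indicator (-{0}) y * h (sgn y))" for y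
      by (auto split: split_indicator)
    show "(\<lambda>y. indicator (cball 0 1 - {0}) y * h (sgn y)) \<in> borel_measurable lborel"
      unfolding eq by (intro borel_measurable_times[OF _ meas'] borel_measurable_indicator) auto
    show "integrable lborel (\<lambda>y::'a. C * indicator (cball 0 1) y)"
      using emeasure_bounded_finite[of "cball (0::'a) 1"]
      by (intro integrable_mult_right integrable_real_indicator) auto
    show "AE y in lborel. norm (\<phi> n ((norm y)\<^sup>2) * h (sgn y)) \<le> C * indicator (cball 0 1) y" for n
    proof (rule AE_I2)
      fix y :: 'a
      consider "y = 0" | "norm y > 1" | "y \<noteq> 0" "norm y \<le> 1" by fastforce
      then show "norm (\<phi> n ((norm y)\<^sup>2) * h (sgn y)) \<le> C * indicator (cball 0 1) y"
      proof cases
        case 1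
        obtain b :: 'a where "b \<in> Basis" using nonempty_Basis by blast
        then have "C \<ge> 0" using C[of b] by simp
        then show ?thesis using 1 by (simp add: \<phi>_def)
      next
        case 2
        then have "(norm y)\<^sup>2 \<ge> 1" by (simp add: one_le_power)
        then show ?thesis using 2 by (simp add: zero')
      next
        case 3
        then have "\<bar>\<phi> n ((norm y)\<^sup>2)\<bar> * \<bar>h (sgn y)\<bar> \<le> 1 * C"
          using C[OF sgn[OF 3(1)]] range[of "(norm y)\<^sup>2" n] by (intro mult_mono) (auto simp: power_le_one)
        then show ?thesis using 3 by (simp add: abs_mult)
      qed
    qed
    \<comment> \<open>On the unit sphere every cutoff is 0 while the indicator of the closed ball is
      1, so the pointwise limit is claimed only off this null set.\<close>
    have "AE y::'a in lborel. y \<notin> sphere 0 1"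
    proof (rule AE_not_in)
      have "sphere 0 1 \<in> null_sets (lebesgue :: 'a measure)"
        using negligible_sphere negligible_iff_null_sets by blast
      then show "sphere 0 1 \<in> null_sets (lborel :: 'a measure)"
        by (subst (asm) null_sets_completion_iff) auto
    qed
    then show "AE y in lborel. (\<lambda>n. \<phi> n ((norm y)\<^sup>2) * h (sgn y)) \<longlonglongrightarrow>
        indicator (cball 0 1 - {0}) y * h (sgn y)"
    proof eventually_elim
      case (elim y)
      then consider "y = 0" | "norm y > 1" | "y \<noteq> 0" "norm y < 1" by force
      then show ?case
      proof cases
        case 1
        then show ?thesis by (simp add: \<phi>_def)
      next
        case 2
        then have "(norm y)\<^sup>2 \<ge> 1" by (simp add: one_le_power)
        then show ?thesis using 2 by (simp add: zero')
      next
        case 3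
        then have "(norm y)\<^sup>2 < 1" by (simp add: power_less_one_iff)
        then have "(\<lambda>n. \<phi> n ((norm y)\<^sup>2) * h (sgn y)) \<longlonglongrightarrow> 1 * h (sgn y)"
          using 3 by (intro tendsto_intros lim) auto
        then show ?thesis using 3 by simp
      qed
    qed
  qed
  then have "(\<integral>y. indicator (cball 0 1 - {0}) y * h (sgn y) \<partial>lborel) = 0"
    using zero by (simp add: LIMSEQ_const_iff)
  then show ?thesis
    using integral_sphere_vol[OF cont_h] by (simp add: h_def sgn_div_norm)
qed

section \<open>Derivatives of variations\<close>

text \<open>The second difference is the increment of \<open>\<psi>\<close>, itself a difference in
  direction \<open>w\<close>. The mean value theorem along \<open>u\<close> brings in
  \<open>f'\<close>, and applied once more along \<open>w\<close> it brings in \<open>f''\<close>;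
  the triangle inequality keeps the intermediate point within \<open>r\<close>.\<close>

lemma second_difference_mean_value:
  fixes f :: "'a::euclidean_space \<Rightarrow> real"
  assumes f: "\<And>y. dist z y < r \<Longrightarrow> (f has_derivative f' y) (at y)"
    and f': "\<And>y. dist z y < r \<Longrightarrow> ((\<lambda>y. f' y u) has_derivative f'' y) (at y)"
    and h: "0 < h" "h * (norm u + norm w) < r"
  shows "\<exists>p. dist z p < r \<and>
    f (z + h *\<^sub>R u + h *\<^sub>R w) - f (z + h *\<^sub>R u) - f (z + h *\<^sub>R w) + f z = h\<^sup>2 * f'' p w"
proof -
  have near: "dist z (z + s *\<^sub>R u + t *\<^sub>R w) < r" if "0 \<le> s" "s \<le> h" "0 \<le> t" "t \<le> h" for s t
  proof -
    have "dist z (z + s *\<^sub>R u + t *\<^sub>R w) = norm (s *\<^sub>R u + t *\<^sub>R w)"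
      unfolding dist_norm by (subst norm_minus_commute) (simp add: add.assoc)
    also have "\<dots> \<le> s * norm u + t * norm w"
      using that norm_triangle_ineq[of "s *\<^sub>R u" "t *\<^sub>R w"] by simp
    also have "\<dots> \<le> h * norm u + h * norm w"
      using that by (intro add_mono mult_right_mono) auto
    finally show ?thesis using h(2) by (simp add: distrib_left)
  qed
  have line: "((\<lambda>s. F (a + s *\<^sub>R v)) has_real_derivative F' v) (at s)"
    if "(F has_derivative F') (at (a + s *\<^sub>R v))" for F :: "'a \<Rightarrow> real" and F' a v s
  proof -
    have "((\<lambda>s. F (a + s *\<^sub>R v)) has_derivative (\<lambda>k. F' (k *\<^sub>R v))) (at s)"
      by (rule has_derivative_compose[where g = F]) (auto intro!: derivative_eq_intros that)
    then show ?thesis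
      using linear_scale[OF has_derivative_linear[OF that]]
      by (simp add: has_field_derivative_def mult_commute_abs)
  qed
  define \<psi> where "\<psi> = (\<lambda>s. f (z + h *\<^sub>R w + s *\<^sub>R u) - f (z + s *\<^sub>R u))"
  have "\<exists>\<xi>>0. \<xi> < h \<and> \<psi> h - \<psi> 0 = (h - 0) * (f' (z + h *\<^sub>R w + \<xi> *\<^sub>R u) u - f' (z + \<xi> *\<^sub>R u) u)"
  proof (rule MVT2)
    fix s assume "0 \<le> s" "s \<le> h"
    then show "(\<psi> has_real_derivative f' (z + h *\<^sub>R w + s *\<^sub>R u) u - f' (z + s *\<^sub>R u) u) (at s)"
      unfolding \<psi>_def using near[of s 0] near[of s h] h(1)
      by (intro DERIV_diff line f) (auto simp: algebra_simps)
  qed (use h in auto)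
  then obtain \<xi> where \<xi>: "0 < \<xi>" "\<xi> < h"
    "\<psi> h - \<psi> 0 = h * (f' (z + h *\<^sub>R w + \<xi> *\<^sub>R u) u - f' (z + \<xi> *\<^sub>R u) u)"
    by auto
  have "\<exists>\<eta>>0. \<eta> < h \<and> f' (z + \<xi> *\<^sub>R u + h *\<^sub>R w) u - f' (z + \<xi> *\<^sub>R u + 0 *\<^sub>R w) u =
      (h - 0) * f'' (z + \<xi> *\<^sub>R u + \<eta> *\<^sub>R w) w"
  proof (rule MVT2)
    fix t assume "0 \<le> t" "t \<le> h"
    then show "((\<lambda>t. f' (z + \<xi> *\<^sub>R u + t *\<^sub>R w) u) has_real_derivative f'' (z + \<xi> *\<^sub>R u + t *\<^sub>R w) w) (at t)"
      using \<xi> near[of \<xi> t] by (intro line[where F = "\<lambda>y. f' y u"] f') auto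
  qed (use h in auto)
  then obtain \<eta> where \<eta>: "0 < \<eta>" "\<eta> < h"
    "f' (z + \<xi> *\<^sub>R u + h *\<^sub>R w) u - f' (z + \<xi> *\<^sub>R u) u = h * f'' (z + \<xi> *\<^sub>R u + \<eta> *\<^sub>R w) w"
    by auto
  have swap: "z + h *\<^sub>R w + \<xi> *\<^sub>R u = z + \<xi> *\<^sub>R u + h *\<^sub>R w" "z + h *\<^sub>R w + h *\<^sub>R u = z + h *\<^sub>R u + h *\<^sub>R w"
    by (simp_all add: ac_simps)
  have "\<psi> h - \<psi> 0 = h\<^sup>2 * f'' (z + \<xi> *\<^sub>R u + \<eta> *\<^sub>R w) w"
    unfolding \<xi>(3) swap \<eta>(3) by (simp add: power2_eq_square)
  moreover have "\<psi> h - \<psi> 0 = f (z + h *\<^sub>R u + h *\<^sub>R w) - f (z + h *\<^sub>R u) - f (z + h *\<^sub>R w) + f z"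
    unfolding \<psi>_def swap by simp
  ultimately show ?thesis
    using near[of \<xi> \<eta>] \<xi> \<eta> by (intro exI[of _ "z + \<xi> *\<^sub>R u + \<eta> *\<^sub>R w"]) auto
qed

text \<open>The second difference is symmetric in \<open>u\<close> and \<open>w\<close>, so the two
  mixed derivatives agree at two points \<open>p\<close> and \<open>q\<close> arbitrarily close to
  \<open>z\<close>; continuity carries the equality to \<open>z\<close>.\<close>

lemma second_derivative_symmetric_real:
  fixes f :: "'a::euclidean_space \<Rightarrow> real"
  assumes U: "open U" "z \<in> U"
    and f: "\<And>y. y \<in> U \<Longrightarrow> (f has_derivative f' y) (at y)"
    and fu: "\<And>y. y \<in> U \<Longrightarrow> ((\<lambda>y. f' y u) has_derivative fu y) (at y)"
    and fw: "\<And>y. y \<in> U \<Longrightarrow> ((\<lambda>y. f' y w) has_derivative fw y) (at y)"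
    and cont: "continuous_on U (\<lambda>y. fu y w)" "continuous_on U (\<lambda>y. fw y u)"
  shows "fu z w = fw z u"
proof -
  have "\<bar>fu z w - fw z u\<bar> \<le> e" if e: "e > 0" for e
  proof -
    obtain r0 where r0: "r0 > 0" "ball z r0 \<subseteq> U"
      using U openE by blast
    have "isCont (\<lambda>y. fu y w) z" "isCont (\<lambda>y. fw y u) z"
      using cont U by (auto simp: continuous_on_eq_continuous_at)
    then obtain r1 r2 where r1: "r1 > 0" "\<And>y. dist y z < r1 \<Longrightarrow> dist (fu y w) (fu z w) < e / 2"
      and r2: "r2 > 0" "\<And>y. dist y z < r2 \<Longrightarrow> dist (fw y u) (fw z u) < e / 2"
      using e unfolding continuous_at_eps_delta by (metis half_gt_zero)
    define r where "r = min r0 (min r1 r2)"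
    \<comment> \<open>The summand 1 keeps the denominator positive when both directions vanish and
      makes the later bound by \<open>r\<close> strict.\<close>
    define h where "h = r / (norm u + norm w + 1)"
    have r: "r > 0" using r0 r1 r2 by (simp add: r_def)
    have pos: "norm u + norm w + 1 > 0" by (simp add: add_nonneg_pos)
    have h: "h > 0" using r pos by (simp add: h_def)
    have "h * (norm u + norm w) < h * (norm u + norm w + 1)"
      using h by simp
    also have "\<dots> = r" using pos by (simp add: h_def)
    finally have hr: "h * (norm u + norm w) < r" "h * (norm w + norm u) < r"
      by (simp_all add: add.commute)
    have inU: "y \<in> U" if "dist z y < r" for y
      using that r0(2) by (auto simp: r_def)
    obtain p where p: "dist z p < r"
      "f (z + h *\<^sub>R u + h *\<^sub>R w) - f (z + h *\<^sub>R u) - f (z + h *\<^sub>R w) + f z = h\<^sup>2 * fu p w"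
      using second_difference_mean_value[of z r f f' u fu h w] f fu inU h hr by blast
    obtain q where q: "dist z q < r"
      "f (z + h *\<^sub>R w + h *\<^sub>R u) - f (z + h *\<^sub>R w) - f (z + h *\<^sub>R u) + f z = h\<^sup>2 * fw q u"
      using second_difference_mean_value[of z r f f' w fw h u] f fw inU h hr by blast
    have swap: "z + h *\<^sub>R w + h *\<^sub>R u = z + h *\<^sub>R u + h *\<^sub>R w" by (simp add: ac_simps)
    have "h\<^sup>2 * fu p w = h\<^sup>2 * fw q u"
      using p(2) q(2) unfolding swap by linarith
    then have "fu p w = fw q u" using h by simp
    moreover have "dist (fu p w) (fu z w) < e / 2" "dist (fw q u) (fw z u) < e / 2"
      using p(1) q(1) r1(2) r2(2) by (auto simp: r_def dist_commute)
    ultimately show ?thesis unfolding dist_real_def by linarith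
  qed
  then have "\<bar>fu z w - fw z u\<bar> \<le> 0" by (rule field_le_epsilon) simp
  then show ?thesis by simp
qed

lemma Ck_on_Suc_has_derivative:
  assumes "Ck_on (Suc k) g U" "y \<in> U"
  shows "(g has_derivative frechet_derivative g (at y)) (at y)"
  using assms by (simp flip: frechet_derivative_works)

lemma second_derivative_symmetric:
  fixes g :: "'a::euclidean_space \<Rightarrow> 'b::euclidean_space"
  assumes U: "open U" "z \<in> U" and g: "Ck_on (Suc (Suc 0)) g U"
  shows "frechet_derivative (\<lambda>y. frechet_derivative g (at y) u) (at z) w =
    frechet_derivative (\<lambda>y. frechet_derivative g (at y) w) (at z) u"
proof (rule euclidean_eqI)
  fix b :: 'b
  let ?D = "\<lambda>u y. frechet_derivative g (at y) u"
  have D: "Ck_on (Suc 0) (?D u) U" for u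
    using g by simp
  have "((\<lambda>y. ?D u y \<bullet> b) has_derivative (\<lambda>h. frechet_derivative (?D u) (at y) h \<bullet> b)) (at y)"
    if "y \<in> U" for y u
    using Ck_on_Suc_has_derivative[OF D that] by (rule has_derivative_inner_left)
  moreover have "((\<lambda>y. g y \<bullet> b) has_derivative (\<lambda>h. ?D h y \<bullet> b)) (at y)" if "y \<in> U" for y
    using Ck_on_Suc_has_derivative[OF g that] by (rule has_derivative_inner_left)
  moreover have "continuous_on U (\<lambda>y. frechet_derivative (?D u) (at y) w \<bullet> b)" for u w
    using D[of u] by (auto intro!: continuous_intros)
  ultimately show "frechet_derivative (?D u) (at z) w \<bullet> b = frechet_derivative (?D w) (at z) u \<bullet> b"
    by (intro second_derivative_symmetric_real[OF U, where f = "\<lambda>y. g y \<bullet> b"])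
qed

text \<open>\<open>sgn\<close> maps a neighbourhood of \<open>x\<close> onto the sphere, and its
  derivative at \<open>x\<close> is the orthogonal projection to the tangent space; the chain rule
  with the local extension \<open>g\<close> gives differentiability of \<open>f (sgn y)\<close>
  together with its derivative.\<close>

lemma has_derivative_sphere_extension:
  fixes f :: "'a::euclidean_space \<Rightarrow> 'b::euclidean_space"
  assumes x: "x \<in> sphere 0 1" and g: "(g has_derivative g') (at x)"
    and U: "open U" "x \<in> U" "\<And>y. y \<in> sphere 0 1 \<inter> U \<Longrightarrow> f y = g y"
  shows "((\<lambda>y. f (sgn y)) has_derivative (\<lambda>h. g' (h - (x \<bullet> h) *\<^sub>R x))) (at x)"
proof -
  have x0: "x \<noteq> 0" and [simp]: "norm x = 1" using x by auto
  have sgn_x: "sgn x = x" by (simp add: sgn_div_norm)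
  have sgn: "(sgn has_derivative (\<lambda>h. h - (x \<bullet> h) *\<^sub>R x)) (at x)"
    using has_derivative_sgn[OF x0] by (simp add: sgn_x)
  have *: "((\<lambda>y. g (sgn y)) has_derivative (\<lambda>h. g' (h - (x \<bullet> h) *\<^sub>R x))) (at x)"
    by (rule has_derivative_compose[OF sgn]) (simp add: sgn_x g)
  have "(sgn \<longlongrightarrow> x) (at x)"
    using has_derivative_continuous[OF sgn] by (simp add: continuous_at sgn_x)
  then have "\<forall>\<^sub>F y in at x. sgn y \<in> U"
    using U(1,2) by (rule topological_tendstoD)
  moreover have "\<forall>\<^sub>F y in at x. y \<noteq> 0"
    by (rule tendsto_imp_eventually_ne[OF tendsto_ident_at x0])
  ultimately have "\<forall>\<^sub>F y in at x. g (sgn y) = f (sgn y)"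
    by eventually_elim (simp add: U(3) norm_sgn)
  then show ?thesis
    by (rule has_derivative_transform_eventually[OF *]) (use U x in \<open>auto simp: sgn_x\<close>)
qed

lemma continuous_on_local_extension:
  fixes f :: "'a::t2_space \<Rightarrow> 'b::topological_space"
  assumes "\<And>x. x \<in> A \<Longrightarrow> \<exists>U g. open U \<and> x \<in> U \<and> continuous_on U g \<and> (\<forall>y\<in>A \<inter> U. f y = g y)"
  shows "continuous_on A f"
  unfolding continuous_on_eq_continuous_within
proof
  fix x assume x: "x \<in> A"
  obtain U g where "open U \<and> x \<in> U \<and> continuous_on U g \<and> (\<forall>y\<in>A \<inter> U. f y = g y)"
    using assms[OF x] by (elim exE)
  then have U: "open U" "x \<in> U" "continuous_on U g" "\<And>y. y \<in> A \<inter> U \<Longrightarrow> f y = g y"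
    by auto
  then have "continuous_on (A \<inter> U) f"
    using continuous_on_cong[of "A \<inter> U" "A \<inter> U" f g] continuous_on_subset[OF U(3), of "A \<inter> U"] by simp
  then have "continuous (at x within A \<inter> U) f"
    using x U(2) by (simp add: continuous_on_eq_continuous_within)
  moreover have "at x within A \<inter> U = at x within A"
    by (rule at_within_nhd[OF U(2,1)]) auto
  ultimately show "continuous (at x within A) f"
    by simp
qed

lemma smooth_map_on_imp_continuous_on:
  assumes "smooth_map_on A f"
  shows "continuous_on A f"
proof (rule continuous_on_local_extension)
  fix x assume "x \<in> A"
  then obtain U g where "open U \<and> x \<in> U \<and> (\<forall>k. Ck_on k g U) \<and> (\<forall>y\<in>A \<inter> U. g y = f y)"
    using assms unfolding smooth_map_on_def by (elim ballE exE) auto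
  moreover from this have "continuous_on U g" using Ck_on.simps(1) by blast
  ultimately show "\<exists>U g. open U \<and> x \<in> U \<and> continuous_on U g \<and> (\<forall>y\<in>A \<inter> U. f y = g y)"
    by (intro exI[of _ U] exI[of _ g]) simp
qed

section \<open>Time and space derivatives of smooth families on the sphere\<close>

context
  fixes F :: "real \<Rightarrow> 'a::euclidean_space \<Rightarrow> 'b::euclidean_space"
    and A :: "(real \<times> 'a) set" and I :: "real set" and F\<^sub>t
  defines "A \<equiv> I \<times> sphere 0 1"
    and "F\<^sub>t \<equiv> \<lambda>t x. vector_derivative (\<lambda>\<tau>. F \<tau> x) (at t)"
  assumes I: "open I"
begin

text \<open>For fixed \<open>x\<close> on the sphere all times near \<open>t\<close> stay in
  \<open>A \<inter> U\<close>, since \<open>I\<close> and \<open>U\<close> are open. There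
  \<open>g\<close> agrees with \<open>F\<close>, so its partial derivative in time does not depend
  on the extension.\<close>

lemma time_derivative_extension:
  assumes U: "open U" "(t, x) \<in> A \<inter> U" and eq: "\<And>z. z \<in> A \<inter> U \<Longrightarrow> g z = F (fst z) (snd z)"
    and g: "(g has_derivative g') (at (t, x))"
  shows "((\<lambda>\<tau>. F \<tau> x) has_vector_derivative g' (1, 0)) (at t)" and "F\<^sub>t t x = g' (1, 0)"
proof -
  have "((\<lambda>\<tau>. g (\<tau>, x)) has_derivative (\<lambda>h. g' (h, 0))) (at t)"
    by (rule has_derivative_compose[OF has_derivative_Pair[OF has_derivative_ident has_derivative_const] g])
  moreover have "(\<lambda>h. g' (h, 0)) = (\<lambda>h. h *\<^sub>R g' (1, 0))"
  proof
    show "g' (h, 0) = h *\<^sub>R g' (1, 0)" for h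
      using linear_scale[OF has_derivative_linear[OF g], of h "(1, 0)"] by simp
  qed
  ultimately have *: "((\<lambda>\<tau>. g (\<tau>, x)) has_vector_derivative g' (1, 0)) (at t)"
    by (simp only: has_vector_derivative_def)
  have "continuous_on UNIV (\<lambda>\<tau>::real. (\<tau>, x))"
    by (rule continuous_on_Pair[OF continuous_on_id continuous_on_const])
  then have "open ((\<lambda>\<tau>. (\<tau>, x)) -` U \<inter> I)"
    by (rule open_Int[OF open_vimage[OF U(1)] I])
  moreover have "t \<in> (\<lambda>\<tau>. (\<tau>, x)) -` U \<inter> I"
    using U by (auto simp: A_def)
  moreover have "g (\<tau>, x) = F \<tau> x" if "\<tau> \<in> (\<lambda>\<tau>. (\<tau>, x)) -` U \<inter> I" for \<tau>
    using that U(2) eq[of "(\<tau>, x)"] by (auto simp: A_def)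
  ultimately show "((\<lambda>\<tau>. F \<tau> x) has_vector_derivative g' (1, 0)) (at t)"
    by (rule has_vector_derivative_transform_within_open[OF *])
  then show "F\<^sub>t t x = g' (1, 0)"
    by (simp add: F\<^sub>t_def vector_derivative_at)
qed

lemma space_derivative_extension:
  assumes U: "open U" "(t, x) \<in> A \<inter> U" and eq: "\<And>z. z \<in> A \<inter> U \<Longrightarrow> g z = F (fst z) (snd z)"
    and g: "(g has_derivative g') (at (t, x))"
  shows "((\<lambda>y. F t (sgn y)) has_derivative (\<lambda>h. g' (0, h - (x \<bullet> h) *\<^sub>R x))) (at x)"
    and "sphere_deriv (F t) x = (\<lambda>h. g' (0, h - (x \<bullet> h) *\<^sub>R x))"
proof -
  have "((\<lambda>y. g (t, y)) has_derivative (\<lambda>h. g' (0, h))) (at x)"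
    by (rule has_derivative_compose[OF has_derivative_Pair[OF has_derivative_const has_derivative_ident] g])
  moreover have "open (Pair t -` U)" "x \<in> Pair t -` U"
    using U by (auto intro!: open_vimage continuous_intros)
  moreover have "F t y = g (t, y)" if "y \<in> sphere 0 1 \<inter> (Pair t -` U)" for y
    using that U(2) eq[of "(t, y)"] by (auto simp: A_def)
  moreover have "x \<in> sphere 0 1" using U by (simp add: A_def)
  ultimately show "((\<lambda>y. F t (sgn y)) has_derivative (\<lambda>h. g' (0, h - (x \<bullet> h) *\<^sub>R x))) (at x)"
    by (intro has_derivative_sphere_extension[where g = "\<lambda>y. g (t, y)"]) auto
  then show "sphere_deriv (F t) x = (\<lambda>h. g' (0, h - (x \<bullet> h) *\<^sub>R x))"
    unfolding sphere_deriv_sgn by (rule frechet_derivative_at[symmetric])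
qed

context
  assumes F: "smooth_map_on A (\<lambda>(t, x). F t x)"
begin

lemma local_extension:
  assumes "z \<in> A"
  obtains U g where "open U" "z \<in> U" "\<And>k. Ck_on k g U" "\<And>z. z \<in> A \<inter> U \<Longrightarrow> g z = F (fst z) (snd z)"
proof -
  obtain U g where "open U \<and> z \<in> U \<and> (\<forall>k. Ck_on k g U) \<and> (\<forall>y\<in>A \<inter> U. g y = F (fst y) (snd y))"
    using bspec[OF F[unfolded smooth_map_on_def case_prod_beta] assms] by (elim exE)
  then show ?thesis using that[of U g] by simp
qed

lemma has_time_derivative:
  assumes "(t, x) \<in> A"
  shows "((\<lambda>\<tau>. F \<tau> x) has_vector_derivative F\<^sub>t t x) (at t)"
proof -
  obtain U g where g: "open U" "(t, x) \<in> U" "\<And>k. Ck_on k g U" "\<And>z. z \<in> A \<inter> U \<Longrightarrow> g z = F (fst z) (snd z)"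
    using local_extension[OF assms] by blast
  have "(g has_derivative frechet_derivative g (at (t, x))) (at (t, x))"
    using Ck_on_Suc_has_derivative[OF g(3) g(2)] .
  from time_derivative_extension[OF g(1) _ g(4) this] show ?thesis
    using assms g(2) by simp
qed

text \<open>The partial time derivative of a local extension of \<open>F\<close> is a local
  extension of \<open>F\<^sub>t\<close>, with one order of differentiability less; all orders are
  available.\<close>

lemma smooth_time_derivative: "smooth_map_on A (\<lambda>(t, x). F\<^sub>t t x)"
  unfolding smooth_map_on_def
proof
  fix z assume z: "z \<in> A"
  then obtain U g where g: "open U" "z \<in> U" "\<And>k. Ck_on k g U" "\<And>z. z \<in> A \<inter> U \<Longrightarrow> g z = F (fst z) (snd z)"
    using local_extension by blast
  have "Ck_on k (\<lambda>z. frechet_derivative g (at z) (1, 0)) U" for k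
    using g(3)[of "Suc k"] by (simp del: split_paired_All)
  moreover have "frechet_derivative g (at y) (1, 0) = (case y of (t, x) \<Rightarrow> F\<^sub>t t x)" if "y \<in> A \<inter> U" for y
  proof (cases y)
    case (Pair t x)
    then show ?thesis
      using time_derivative_extension(2)[OF g(1) _ g(4) Ck_on_Suc_has_derivative[OF g(3)], of t x] that
      by simp
  qed
  ultimately show "\<exists>U g. open U \<and> z \<in> U \<and> (\<forall>k. Ck_on k g U) \<and>
      (\<forall>y\<in>A \<inter> U. g y = (case y of (t, x) \<Rightarrow> F\<^sub>t t x))"
    using g(1,2) by blast
qed

lemma has_space_derivative:
  assumes "(t, x) \<in> A"
  shows "((\<lambda>y. F t (sgn y)) has_derivative sphere_deriv (F t) x) (at x)"
proof -
  obtain U g where g: "open U" "(t, x) \<in> U" "\<And>k. Ck_on k g U" "\<And>z. z \<in> A \<inter> U \<Longrightarrow> g z = F (fst z) (snd z)"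
    using local_extension[OF assms] by blast
  have "(g has_derivative frechet_derivative g (at (t, x))) (at (t, x))"
    using Ck_on_Suc_has_derivative[OF g(3) g(2)] .
  from space_derivative_extension[OF g(1) _ g(4) this] show ?thesis
    using assms g(2) by simp
qed

lemma continuous_on_space_derivative: "continuous_on A (\<lambda>(t, x). sphere_deriv (F t) x v)"
proof (rule continuous_on_local_extension)
  fix z assume "z \<in> A"
  then obtain U g where g: "open U" "z \<in> U" "\<And>k. Ck_on k g U" "\<And>z. z \<in> A \<inter> U \<Longrightarrow> g z = F (fst z) (snd z)"
    using local_extension by blast
  let ?D = "\<lambda>z. frechet_derivative g (at z)"
  \<comment> \<open>\<open>Ck_on\<close> gives continuity of the derivative in fixed directions, but
    the projection of \<open>v\<close> to the tangent space moves with the point. Linearity splits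
    it into fixed basis directions with continuous coefficients.\<close>
  let ?G = "\<lambda>z. ?D z (0, v) - (snd z \<bullet> v) *\<^sub>R (\<Sum>b\<in>Basis. (snd z \<bullet> b) *\<^sub>R ?D z (0, b))"
  have "continuous_on U (\<lambda>z. ?D z w)" for w
    using g(3)[of "Suc 0"] by (simp del: split_paired_All)
  then have "continuous_on U ?G"
    by (intro continuous_intros)
  moreover have "(case y of (t, x) \<Rightarrow> sphere_deriv (F t) x v) = ?G y" if y: "y \<in> A \<inter> U" for y
  proof (cases y)
    case (Pair t x)
    have der: "(g has_derivative ?D (t, x)) (at (t, x))"
      using Ck_on_Suc_has_derivative[OF g(3)] y Pair by blast
    have lin: "linear (?D (t, x))"
      using der by (rule has_derivative_linear)
    have "sphere_deriv (F t) x v = ?D (t, x) (0, v - (x \<bullet> v) *\<^sub>R x)"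
      using space_derivative_extension(2)[OF g(1) _ g(4) der] y Pair by simp
    also have "(0, v - (x \<bullet> v) *\<^sub>R x) = (0, v) - (x \<bullet> v) *\<^sub>R (\<Sum>b\<in>Basis. (x \<bullet> b) *\<^sub>R (0::real, b))"
    proof -
      have "(\<Sum>b\<in>Basis. (x \<bullet> b) *\<^sub>R (0::real, b)) = (0, x)"
        by (rule prod_eqI) (simp_all add: fst_sum snd_sum euclidean_representation)
      then show ?thesis by simp
    qed
    also have "?D (t, x) \<dots> = ?G (t, x)"
      by (simp only: linear_diff[OF lin] linear_scale[OF lin] linear_sum[OF lin] snd_conv)
    finally show ?thesis using Pair by simp
  qed
  ultimately show "\<exists>U G. open U \<and> z \<in> U \<and> continuous_on U G \<and>
      (\<forall>y\<in>A \<inter> U. (case y of (t, x) \<Rightarrow> sphere_deriv (F t) x v) = G y)"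
    using g(1,2) by (intro exI[of _ U] exI[of _ ?G]) simp
qed

end

end

text \<open>Both sides are second derivatives of one local extension \<open>g\<close>, in the
  directions \<open>(1, 0)\<close> and \<open>(0, w)\<close> with \<open>w\<close> the tangential
  part of \<open>v\<close>, taken in opposite orders.\<close>

lemma has_time_derivative_sphere_deriv:
  fixes F :: "real \<Rightarrow> 'a::euclidean_space \<Rightarrow> 'b::euclidean_space"
  assumes I: "open I" and F: "smooth_map_on (I \<times> sphere 0 1) (\<lambda>(t, x). F t x)"
    and tx: "t \<in> I" "x \<in> sphere 0 1"
  shows "((\<lambda>\<tau>. sphere_deriv (F \<tau>) x v) has_vector_derivative
    sphere_deriv (\<lambda>x. vector_derivative (\<lambda>\<tau>. F \<tau> x) (at t)) x v) (at t)"
proof -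
  let ?A = "I \<times> sphere 0 1"
  let ?Ft = "\<lambda>t x. vector_derivative (\<lambda>\<tau>. F \<tau> x) (at t)"
  have txA: "(t, x) \<in> ?A" using tx by simp
  obtain U g where g: "open U" "(t, x) \<in> U" "\<And>k. Ck_on k g U" "\<And>z. z \<in> ?A \<inter> U \<Longrightarrow> g z = F (fst z) (snd z)"
    using local_extension[OF I F txA] by blast
  let ?D = "\<lambda>z. frechet_derivative g (at z)"
  have der: "(g has_derivative ?D z) (at z)" if "z \<in> U" for z
    using Ck_on_Suc_has_derivative[OF g(3) that] .
  have D: "Ck_on k (\<lambda>z. ?D z w) U" for k w
    using g(3)[of "Suc k"] by (simp del: split_paired_All)
  define w where "w = v - (x \<bullet> v) *\<^sub>R x"
  have 1: "?D z (1, 0) = ?Ft (fst z) (snd z)" if "z \<in> ?A \<inter> U" for z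
    using time_derivative_extension(2)[OF I g(1) _ g(4) der, of "fst z" "snd z"] that by simp
  have 2: "?D z (0, w) = sphere_deriv (F (fst z)) x v" if "z \<in> ?A \<inter> U" "snd z = x" for z
    using space_derivative_extension(2)[OF I g(1) _ g(4) der, of "fst z" "snd z"] that
    by (cases z) (simp add: w_def)
  have "sphere_deriv (?Ft t) x v = frechet_derivative (\<lambda>z. ?D z (1, 0)) (at (t, x)) (0, w)"
    using space_derivative_extension(2)[OF I g(1) _ 1 Ck_on_Suc_has_derivative[OF D]] txA g(2)
    by (simp add: w_def)
  also have "\<dots> = frechet_derivative (\<lambda>z. ?D z (0, w)) (at (t, x)) (1, 0)"
    by (rule second_derivative_symmetric[OF g(1,2,3)])
  finally have eq: "sphere_deriv (?Ft t) x v = frechet_derivative (\<lambda>z. ?D z (0, w)) (at (t, x)) (1, 0)" .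
  have "((\<lambda>\<tau>. ?D (\<tau>, x) (0, w)) has_derivative
      (\<lambda>h. frechet_derivative (\<lambda>z. ?D z (0, w)) (at (t, x)) (h, 0))) (at t)"
    by (rule has_derivative_compose[OF has_derivative_Pair[OF has_derivative_ident has_derivative_const]
          Ck_on_Suc_has_derivative[OF D g(2)]])
  moreover have "frechet_derivative (\<lambda>z. ?D z (0, w)) (at (t, x)) (h, 0) = h *\<^sub>R sphere_deriv (?Ft t) x v" for h
    using linear_scale[OF has_derivative_linear[OF Ck_on_Suc_has_derivative[OF D g(2)]], of "(0, w)" h "(1, 0)"]
    by (simp add: eq)
  ultimately have *: "((\<lambda>\<tau>. ?D (\<tau>, x) (0, w)) has_vector_derivative sphere_deriv (?Ft t) x v) (at t)"
    by (simp add: has_vector_derivative_def)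
  have "continuous_on UNIV (\<lambda>\<tau>::real. (\<tau>, x))"
    by (rule continuous_on_Pair[OF continuous_on_id continuous_on_const])
  then have "open ((\<lambda>\<tau>. (\<tau>, x)) -` U \<inter> I)"
    by (rule open_Int[OF open_vimage[OF g(1)] I])
  moreover have "t \<in> (\<lambda>\<tau>. (\<tau>, x)) -` U \<inter> I"
    using g(2) tx by auto
  moreover have "?D (\<tau>, x) (0, w) = sphere_deriv (F \<tau>) x v" if "\<tau> \<in> (\<lambda>\<tau>. (\<tau>, x)) -` U \<inter> I" for \<tau>
    using that tx 2[of "(\<tau>, x)"] by auto
  ultimately show ?thesis
    by (rule has_vector_derivative_transform_within_open[OF *])
qed

section \<open>The first variation of the energy\<close>

lemma sum_inner_linear:
  assumes "linear f"
  shows "(\<Sum>b\<in>Basis. (w \<bullet> b) * (v \<bullet> f b)) = v \<bullet> f w"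
proof -
  have "f w = f (\<Sum>b\<in>Basis. (w \<bullet> b) *\<^sub>R b)"
    by (simp add: euclidean_representation)
  also have "\<dots> = (\<Sum>b\<in>Basis. (w \<bullet> b) *\<^sub>R f b)"
    by (simp only: linear_sum[OF assms] linear_scale[OF assms])
  finally show ?thesis
    by (simp add: inner_sum_right)
qed

text \<open>The Hilbert-Schmidt norm does not depend on the basis: expand \<open>f e\<close> in
  \<open>Basis\<close>, swap the sums, and apply Parseval in \<open>B\<close> to each
  \<open>adjoint f b\<close>.\<close>

lemma sum_norm_sq_orthonormal:
  fixes f :: "'a::euclidean_space \<Rightarrow> 'b::euclidean_space"
  assumes f: "linear f" and B: "finite B" "pairwise orthogonal B" "\<And>e. e \<in> B \<Longrightarrow> norm e = 1" "span B = UNIV"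
  shows "(\<Sum>e\<in>B. (norm (f e))\<^sup>2) = (\<Sum>b\<in>Basis. (norm (adjoint f b))\<^sup>2)"
proof -
  have parseval: "(\<Sum>e\<in>B. (w \<bullet> e)\<^sup>2) = (norm w)\<^sup>2" for w
  proof -
    have "w = (\<Sum>e\<in>B. (w \<bullet> e) *\<^sub>R e)"
      using orthonormal_basis_expand[OF B(2,3) _ B(1), of w] B(4) by simp
    then have "w \<bullet> w = w \<bullet> (\<Sum>e\<in>B. (w \<bullet> e) *\<^sub>R e)" by simp
    then have "w \<bullet> w = (\<Sum>e\<in>B. (w \<bullet> e)\<^sup>2)"
      by (simp add: inner_sum_right power2_eq_square)
    then show ?thesis by (simp add: power2_norm_eq_inner)
  qed
  have "(\<Sum>e\<in>B. (norm (f e))\<^sup>2) = (\<Sum>e\<in>B. \<Sum>b\<in>Basis. (adjoint f b \<bullet> e)\<^sup>2)"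
  proof (rule sum.cong)
    fix e
    have "(norm (f e))\<^sup>2 = (\<Sum>b\<in>Basis. (f e \<bullet> b)\<^sup>2)"
      unfolding power2_norm_eq_inner by (subst euclidean_inner) (simp add: power2_eq_square)
    moreover have "adjoint f b \<bullet> e = f e \<bullet> b" for b
      using adjoint_clauses(2)[OF f, of b e] by (simp add: inner_commute)
    ultimately show "(norm (f e))\<^sup>2 = (\<Sum>b\<in>Basis. (adjoint f b \<bullet> e)\<^sup>2)"
      by simp
  qed simp
  also have "\<dots> = (\<Sum>b\<in>Basis. \<Sum>e\<in>B. (adjoint f b \<bullet> e)\<^sup>2)"
    by (rule sum.swap)
  finally show ?thesis by (simp add: parseval)
qed

text \<open>Adding \<open>x\<close> completes the tangent frame to an orthonormal basis of the whole
  space, and \<open>f x = 0\<close> makes the added summand vanish. This removes the arbitrary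
  choice in \<open>orthonormal_frame\<close> from the energy.\<close>

lemma sum_orthonormal_frame:
  fixes f :: "'a::euclidean_space \<Rightarrow> 'b::euclidean_space"
  assumes f: "linear f" "f x = 0" and x: "x \<in> sphere 0 1"
  shows "(\<Sum>e\<in>orthonormal_frame x. (norm (f e))\<^sup>2) = (\<Sum>b\<in>Basis. (norm (f b))\<^sup>2)"
proof -
  let ?B = "orthonormal_frame x"
  have B: "pairwise orthogonal ?B" "\<And>e. e \<in> ?B \<Longrightarrow> norm e = 1" "span ?B = tangent_space x"
    using is_orthonormal_frame_orthonormal_frame[of x] by (auto simp: is_orthonormal_frame_def)
  have fin: "finite ?B"
    using B(1) by (rule pairwise_orthogonal_imp_finite)
  have nx: "norm x = 1" "x \<bullet> x = 1" using x by (simp_all add: dot_square_norm)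
  have orth: "x \<bullet> e = 0" if "e \<in> ?B" for e
    using span_base[OF that] B(3) by (simp add: tangent_space_def)
  have "x \<notin> ?B" using orth nx by force
  have "span (insert x ?B) = UNIV"
  proof -
    have "v - (x \<bullet> v) *\<^sub>R x \<in> span ?B" for v
      using nx by (simp add: B(3) tangent_space_def inner_diff_right)
    then show ?thesis unfolding set_eq_iff span_breakdown_eq by blast
  qed
  moreover have "pairwise orthogonal (insert x ?B)"
    using B(1) orth by (auto simp: pairwise_insert orthogonal_def inner_commute)
  ultimately have "(\<Sum>e\<in>insert x ?B. (norm (f e))\<^sup>2) = (\<Sum>b\<in>Basis. (norm (adjoint f b))\<^sup>2)"
    using fin B(2) nx by (intro sum_norm_sq_orthonormal f) auto
  also have "\<dots> = (\<Sum>b\<in>Basis. (norm (f b))\<^sup>2)"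
    by (rule sum_norm_sq_orthonormal[symmetric])
      (auto simp: f pairwise_def orthogonal_def inner_Basis)
  finally show ?thesis
    using fin \<open>x \<notin> ?B\<close> f(2) by simp
qed

text \<open>From \<open>sgn (sgn y) = sgn y\<close> the chain rule shows that \<open>D\<close> is
  unchanged by first projecting to the tangent space, and the projection kills
  \<open>x\<close>.\<close>

lemma has_derivative_sgn_radial:
  fixes f :: "'a::euclidean_space \<Rightarrow> 'b::euclidean_space"
  assumes D: "((\<lambda>y. f (sgn y)) has_derivative D) (at x)" and x: "x \<in> sphere 0 1"
  shows "D x = 0"
proof -
  have x0: "x \<noteq> 0" and nx: "norm x = 1" using x by auto
  have sgn_x: "sgn x = x" using nx by (simp add: sgn_div_norm)
  have "((\<lambda>y. f (sgn (sgn y))) has_derivative (\<lambda>h. D ((h - (sgn x \<bullet> h) *\<^sub>R sgn x) /\<^sub>R norm x))) (at x)"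
    by (rule has_derivative_compose[OF has_derivative_sgn[OF x0], where g = "\<lambda>y. f (sgn y)"])
      (simp add: sgn_x D)
  moreover have "sgn (sgn y) = sgn y" for y :: 'a
    by (cases "y = 0") (simp_all add: sgn_div_norm[of "sgn y"] norm_sgn)
  ultimately have "((\<lambda>y. f (sgn y)) has_derivative (\<lambda>h. D (h - (x \<bullet> h) *\<^sub>R x))) (at x)"
    by (simp add: sgn_x nx)
  from has_derivative_unique[OF D this] have "D x = D (x - (x \<bullet> x) *\<^sub>R x)"
    by (rule fun_cong)
  also have "\<dots> = 0"
    using nx linear_0[OF has_derivative_linear[OF D]] by (simp add: dot_square_norm)
  finally show ?thesis .
qed

lemma sphere_deriv_eq:
  assumes "((\<lambda>y. f (sgn y)) has_derivative D) (at x)"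
  shows "sphere_deriv f x = D"
  unfolding sphere_deriv_sgn using assms by (rule frechet_derivative_at[symmetric])

lemma covd_norm_sq_eq:
  fixes X :: "'a::euclidean_space \<Rightarrow> 'a"
  assumes D: "((\<lambda>y. X (sgn y)) has_derivative D) (at x)" and x: "x \<in> sphere 0 1"
  shows "covd_norm_sq X x = (\<Sum>b\<in>Basis. D b \<bullet> D b - (D b \<bullet> x)\<^sup>2)"
proof -
  have lin: "linear D" using D by (rule has_derivative_linear)
  have covd: "covd X x v = D v - (D v \<bullet> x) *\<^sub>R x" for v
    by (simp add: covd_def sphere_deriv_eq[OF D])
  have "linear (covd X x)"
    unfolding covd
    by (rule linearI) (simp_all add: linear_add[OF lin] linear_scale[OF lin] algebra_simps)
  then have "covd_norm_sq X x = (\<Sum>b\<in>Basis. (norm (covd X x b))\<^sup>2)"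
    unfolding covd_norm_sq_def
    by (intro sum_orthonormal_frame x) (simp_all add: covd[of x] has_derivative_sgn_radial[OF D x])
  also have "\<dots> = (\<Sum>b\<in>Basis. D b \<bullet> D b - (D b \<bullet> x)\<^sup>2)"
  proof (rule sum.cong)
    fix b
    have "x \<bullet> x = 1" using x by (simp add: dot_square_norm)
    then show "(norm (covd X x b))\<^sup>2 = D b \<bullet> D b - (D b \<bullet> x)\<^sup>2"
      unfolding covd power2_norm_eq_inner by (simp add: inner_diff_left inner_diff_right power2_eq_square inner_commute)
  qed simp
  finally show ?thesis .
qed

text \<open>The defining property of the gradient concerns tangent vectors; it extends to all
  \<open>h\<close> because both sides vanish on the radius.\<close>

lemma sphere_grad_inner:
  fixes f :: "'a::euclidean_space \<Rightarrow> real"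
  assumes D: "((\<lambda>y. f (sgn y)) has_derivative D) (at x)" and x: "x \<in> sphere 0 1"
  shows "sphere_grad f x \<bullet> h = D h"
proof -
  have lin: "linear D" using D by (rule has_derivative_linear)
  have xx: "x \<bullet> x = 1" using x by (simp add: dot_square_norm)
  have "(\<lambda>y. f (y /\<^sub>R norm y)) differentiable (at x)"
    using D by (auto simp: differentiable_def sgn_div_norm)
  note grad = sphere_grad[OF x this]
  have "sphere_grad f x \<bullet> h = sphere_grad f x \<bullet> (h - (x \<bullet> h) *\<^sub>R x)"
    using grad(1) by (simp add: tangent_space_def inner_diff_right inner_commute)
  also have "\<dots> = D (h - (x \<bullet> h) *\<^sub>R x)"
    using xx by (subst grad(2)) (simp_all add: tangent_space_def inner_diff_right sphere_deriv_eq[OF D])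
  also have "\<dots> = D h"
    by (simp add: linear_diff[OF lin] linear_scale[OF lin] has_derivative_sgn_radial[OF D x])
  finally show ?thesis .
qed

lemma norm_sphere_grad:
  fixes f :: "'a::euclidean_space \<Rightarrow> real"
  assumes D: "((\<lambda>y. f (sgn y)) has_derivative D) (at x)" and x: "x \<in> sphere 0 1"
  shows "(norm (sphere_grad f x))\<^sup>2 = (\<Sum>b\<in>Basis. (D b)\<^sup>2)"
  unfolding power2_norm_eq_inner
  by (subst euclidean_inner) (simp add: sphere_grad_inner[OF D x] power2_eq_square)

text \<open>Value \<open>v\<close> and derivative \<open>D\<close> are independent arguments, which
  makes the variation of the integrand a pointwise computation. The term
  \<open>v \<bullet> D b\<close> is the derivative of half the squared norm of the field.\<close>

definition energy_density :: "real \<Rightarrow> real \<Rightarrow> 'a::euclidean_space \<Rightarrow> 'a \<Rightarrow> ('a \<Rightarrow> 'a) \<Rightarrow> real" where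
  "energy_density p q x v D = (1 + v \<bullet> v) powr (- p) *
     (\<Sum>b\<in>Basis. D b \<bullet> D b - (D b \<bullet> x)\<^sup>2 + q * (v \<bullet> D b)\<^sup>2)"

lemma vertical_energy_eq:
  assumes D: "\<And>x. x \<in> sphere 0 1 \<Longrightarrow> ((\<lambda>y. X (sgn y)) has_derivative D x) (at x)"
  shows "vertical_energy p q X = 1/2 * (\<integral>x. energy_density p q x (X x) (D x) \<partial>sphere_vol)"
proof -
  have "1 / (1 + (norm (X x))\<^sup>2) powr p *
     (covd_norm_sq X x + q * (norm (sphere_grad (\<lambda>y. 1/2 * (norm (X y))\<^sup>2) x))\<^sup>2) =
     energy_density p q x (X x) (D x)" if x: "x \<in> sphere 0 1" for x
  proof -
    have sgn_x: "sgn x = x" using x by (simp add: sgn_div_norm)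
    have "((\<lambda>y. 1/2 * (X (sgn y) \<bullet> X (sgn y))) has_derivative
        (\<lambda>h. 1/2 * (X (sgn x) \<bullet> D x h + D x h \<bullet> X (sgn x)))) (at x)"
      by (intro has_derivative_mult_right has_derivative_inner D x)
    then have "((\<lambda>y. 1/2 * (norm (X (sgn y)))\<^sup>2) has_derivative (\<lambda>h. X x \<bullet> D x h)) (at x)"
      by (simp add: sgn_x power2_norm_eq_inner inner_commute)
    from norm_sphere_grad[OF this x] covd_norm_sq_eq[OF D[OF x] x]
    show ?thesis
      by (simp add: energy_density_def sum.distrib sum_distrib_left powr_minus_divide power2_norm_eq_inner)
  qed
  then show ?thesis
    unfolding vertical_energy_def
    by (intro arg_cong[of _ _ "\<lambda>r. 1/2 * r"] Bochner_Integration.integral_cong) auto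
qed

definition energy_density_variation ::
    "real \<Rightarrow> real \<Rightarrow> 'a::euclidean_space \<Rightarrow> 'a \<Rightarrow> 'a \<Rightarrow> ('a \<Rightarrow> 'a) \<Rightarrow> ('a \<Rightarrow> 'a) \<Rightarrow> real" where
  "energy_density_variation p q x v v' D D' =
     - p * (1 + v \<bullet> v) powr (- p - 1) * (2 * (v \<bullet> v')) *
       (\<Sum>b\<in>Basis. D b \<bullet> D b - (D b \<bullet> x)\<^sup>2 + q * (v \<bullet> D b)\<^sup>2) +
     (1 + v \<bullet> v) powr (- p) * (\<Sum>b\<in>Basis. 2 * (D b \<bullet> D' b) - 2 * (D b \<bullet> x) * (D' b \<bullet> x) +
       q * (2 * (v \<bullet> D b) * (v' \<bullet> D b + v \<bullet> D' b)))"

lemma has_real_derivative_inner: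
  assumes "(f has_vector_derivative f') (at t)" "(g has_vector_derivative g') (at t)"
  shows "((\<lambda>t. f t \<bullet> g t) has_real_derivative f t \<bullet> g' + f' \<bullet> g t) (at t)"
  using has_derivative_inner[OF assms[unfolded has_vector_derivative_def]]
  by (rule has_derivative_imp_has_field_derivative) (simp add: algebra_simps)

lemma has_real_derivative_energy_density:
  assumes v: "(v has_vector_derivative v') (at t)"
    and D: "\<And>b. ((\<lambda>\<tau>. D \<tau> b) has_vector_derivative D' b) (at t)"
  shows "((\<lambda>\<tau>. energy_density p q x (v \<tau>) (D \<tau>)) has_real_derivative
    energy_density_variation p q x (v t) v' (D t) D') (at t)"
proof -
  have pos: "1 + v t \<bullet> v t > 0" by (simp add: add_pos_nonneg)
  have "((\<lambda>\<tau>. 1 + v \<tau> \<bullet> v \<tau>) has_real_derivative 2 * (v t \<bullet> v')) (at t)"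
    using DERIV_add[OF DERIV_const has_real_derivative_inner[OF v v]]
    by (rule DERIV_cong) (simp add: inner_commute)
  from DERIV_chain2[OF has_real_derivative_powr[OF pos] this]
  have 1: "((\<lambda>\<tau>. (1 + v \<tau> \<bullet> v \<tau>) powr (- p)) has_real_derivative
      - p * (1 + v t \<bullet> v t) powr (- p - 1) * (2 * (v t \<bullet> v'))) (at t)" .
  have Dx: "((\<lambda>\<tau>. (D \<tau> b \<bullet> x)\<^sup>2) has_real_derivative 2 * (D t b \<bullet> x) * (D' b \<bullet> x)) (at t)" for b
    using DERIV_power[OF has_real_derivative_inner[OF D has_vector_derivative_const], of b x 2]
    by (rule DERIV_cong) simp
  have Dv: "((\<lambda>\<tau>. (v \<tau> \<bullet> D \<tau> b)\<^sup>2) has_real_derivative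
      2 * (v t \<bullet> D t b) * (v' \<bullet> D t b + v t \<bullet> D' b)) (at t)" for b
    using DERIV_power[OF has_real_derivative_inner[OF v D], of b 2]
    by (rule DERIV_cong) (simp add: add.commute)
  have DD: "((\<lambda>\<tau>. D \<tau> b \<bullet> D \<tau> b) has_real_derivative 2 * (D t b \<bullet> D' b)) (at t)" for b
    using has_real_derivative_inner[OF D D] by (rule DERIV_cong) (simp add: inner_commute)
  have 2: "((\<lambda>\<tau>. \<Sum>b\<in>Basis. D \<tau> b \<bullet> D \<tau> b - (D \<tau> b \<bullet> x)\<^sup>2 + q * (v \<tau> \<bullet> D \<tau> b)\<^sup>2) has_real_derivative
      (\<Sum>b\<in>Basis. 2 * (D t b \<bullet> D' b) - 2 * (D t b \<bullet> x) * (D' b \<bullet> x) +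
       q * (2 * (v t \<bullet> D t b) * (v' \<bullet> D t b + v t \<bullet> D' b)))) (at t)"
    by (intro DERIV_sum DERIV_add DERIV_diff DERIV_cmult DD Dx Dv)
  show ?thesis
    unfolding energy_density_def energy_density_variation_def
    using DERIV_mult[OF 1 2] by (rule DERIV_cong) (simp add: mult.commute add.commute)
qed

text \<open>The density is differentiated under the integral; the time derivative of
  \<open>sphere_deriv (s t) x\<close> is \<open>sphere_deriv (V t) x\<close>, so the velocity field
  alone describes the variation to first order.\<close>

theorem first_variation:
  fixes s :: "real \<Rightarrow> 'a::euclidean_space \<Rightarrow> 'a"
  defines "V \<equiv> \<lambda>t x. vector_derivative (\<lambda>\<tau>. s \<tau> x) (at t)"
  assumes \<epsilon>: "\<epsilon> > 0" and s: "smooth_map_on ({-\<epsilon><..<\<epsilon>} \<times> sphere 0 1) (\<lambda>(t, x). s t x)"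
  shows "((\<lambda>t. vertical_energy p q (s t)) has_real_derivative
    1/2 * (\<integral>x. energy_density_variation p q x (s 0 x) (V 0 x) (sphere_deriv (s 0) x) (sphere_deriv (V 0) x)
      \<partial>sphere_vol)) (at 0)"
    (is "(_ has_real_derivative 1/2 * integral\<^sup>L _ (?e' 0)) _")
proof -
  let ?I = "{-\<epsilon><..<\<epsilon>}" and ?S = "sphere (0::'a) 1"
  let ?A = "?I \<times> ?S"
  let ?e = "\<lambda>t x. energy_density p q x (s t x) (sphere_deriv (s t) x)"
  let ?e' = "\<lambda>t x. energy_density_variation p q x (s t x) (V t x) (sphere_deriv (s t) x) (sphere_deriv (V t) x)"
  have I: "open ?I" by simp
  have V: "smooth_map_on ?A (\<lambda>(t, x). V t x)"
    unfolding V_def by (rule smooth_time_derivative[OF I s])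
  note cont = smooth_map_on_imp_continuous_on[OF s, unfolded case_prod_beta]
    smooth_map_on_imp_continuous_on[OF V, unfolded case_prod_beta]
    continuous_on_space_derivative[OF I s, unfolded case_prod_beta]
    continuous_on_space_derivative[OF I V, unfolded case_prod_beta]
  have pos: "1 + v \<bullet> v \<noteq> 0" for v :: 'a
    by (metis add_pos_nonneg inner_ge_zero less_irrefl zero_less_one)
  have "continuous_on ?A (\<lambda>z. ?e (fst z) (snd z))" "continuous_on ?A (\<lambda>z. ?e' (fst z) (snd z))"
    unfolding energy_density_def energy_density_variation_def
    using pos by (auto intro!: continuous_intros cont)
  note cont_e = this
  \<comment> \<open>Halving yields a compact time interval inside the domain; on its product with
    the sphere the continuous \<open>?e'\<close> is bounded, and the bound is a constant
    majorant.\<close>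
  define \<delta> where "\<delta> = \<epsilon> / 2"
  have \<delta>: "\<delta> > 0" "{-\<delta>..\<delta>} \<subseteq> ?I" using \<epsilon> by (auto simp: \<delta>_def)
  have "bounded ((\<lambda>z. ?e' (fst z) (snd z)) ` ({-\<delta>..\<delta>} \<times> ?S))"
    using \<delta>(2) by (intro compact_imp_bounded compact_continuous_image continuous_on_subset[OF cont_e(2)] compact_Times) auto
  then obtain B where "\<forall>y\<in>(\<lambda>z. ?e' (fst z) (snd z)) ` ({-\<delta>..\<delta>} \<times> ?S). norm y \<le> B"
    unfolding bounded_iff by (elim exE)
  then have B: "\<bar>?e' t x\<bar> \<le> B" if "t \<in> {-\<delta>..\<delta>}" "x \<in> ?S" for t x
    using that unfolding ball_simps real_norm_def by (metis SigmaI fst_conv snd_conv)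
  have "((\<lambda>t. \<integral>x. ?e t x \<partial>sphere_vol) has_real_derivative (\<integral>x. ?e' 0 x \<partial>sphere_vol)) (at 0)"
  proof (rule has_real_derivative_lebesgue_integral(2)[OF \<delta>(1)])
    show "integrable sphere_vol (?e t)" if "\<bar>t\<bar> < \<delta>" for t
    proof (rule integrable_sphere_vol)
      have "t \<in> ?I" using that \<epsilon> by (auto simp: \<delta>_def)
      then show "continuous_on ?S (?e t)"
        using continuous_on_compose2[OF cont_e(1), of ?S "Pair t"] by (force intro!: continuous_intros)
    qed
    show "((\<lambda>\<tau>. ?e \<tau> x) has_real_derivative ?e' t x) (at t)" if "\<bar>t\<bar> < \<delta>" "x \<in> space sphere_vol" for t x
    proof -
      have tx: "t \<in> ?I" "x \<in> ?S" using that \<epsilon> by (auto simp: \<delta>_def)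
      show ?thesis
        using has_time_derivative[OF I s, of t x] has_time_derivative_sphere_deriv[OF I s tx] tx
        by (intro has_real_derivative_energy_density) (auto simp: V_def)
    qed
    show "\<bar>?e' t x\<bar> \<le> B" if "\<bar>t\<bar> < \<delta>" "x \<in> space sphere_vol" for t x
      using that by (intro B) auto
    interpret finite_measure "sphere_vol :: 'a measure" by (rule finite_measure_sphere_vol)
    show "integrable (sphere_vol :: 'a measure) (\<lambda>x. B)" by simp
  qed
  from DERIV_cmult[OF this, of "1/2"]
  have *: "((\<lambda>t. 1/2 * (\<integral>x. ?e t x \<partial>sphere_vol)) has_real_derivative 1/2 * (\<integral>x. ?e' 0 x \<partial>sphere_vol)) (at 0)" .
  show ?thesis
  proof (rule has_field_derivative_transform_within_open[OF * I])
    show "1/2 * (\<integral>x. ?e t x \<partial>sphere_vol) = vertical_energy p q (s t)" if "t \<in> ?I" for t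
      using that by (intro vertical_energy_eq[symmetric] has_space_derivative[OF I s]) auto
  qed (use \<epsilon> in auto)
qed

section \<open>Height gradients\<close>

definition height_grad :: "'a::euclidean_space \<Rightarrow> 'a \<Rightarrow> 'a" where
  "height_grad a x = a - (a \<bullet> x) *\<^sub>R x"

text \<open>The first summand is the component normal to the sphere; the second is the covariant
  derivative, a multiple of the projected direction, which is the conformal equation.\<close>

definition height_grad_deriv :: "'a::euclidean_space \<Rightarrow> 'a \<Rightarrow> 'a \<Rightarrow> 'a" where
  "height_grad_deriv a x h = - (height_grad a x \<bullet> h) *\<^sub>R x - (a \<bullet> x) *\<^sub>R (h - (x \<bullet> h) *\<^sub>R x)"

lemma height_has_derivative:
  assumes x: "x \<in> sphere (0::'a::euclidean_space) 1"
  shows "((\<lambda>y. a \<bullet> sgn y) has_derivative (\<lambda>h. height_grad a x \<bullet> h)) (at x)"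
proof -
  have "((\<lambda>y. a \<bullet> y) has_derivative (\<lambda>h. a \<bullet> h)) (at x)"
    by (rule has_derivative_inner_right[OF has_derivative_ident])
  from has_derivative_sphere_extension[OF x this open_UNIV]
  have "((\<lambda>y. a \<bullet> sgn y) has_derivative (\<lambda>h. a \<bullet> (h - (x \<bullet> h) *\<^sub>R x))) (at x)"
    by simp
  then show ?thesis
    by (rule has_derivative_eq_rhs) (simp add: height_grad_def inner_diff_left inner_diff_right fun_eq_iff)
qed

lemma sphere_grad_height:
  assumes x: "x \<in> sphere (0::'a::euclidean_space) 1"
  shows "sphere_grad (\<lambda>y. a \<bullet> y) x = height_grad a x"
  using sphere_grad_inner[OF height_has_derivative[OF x] x] vector_eq_rdot by blast

lemma height_grad_has_derivative:
  assumes x: "x \<in> sphere (0::'a::euclidean_space) 1"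
  shows "((\<lambda>y. height_grad a (sgn y)) has_derivative height_grad_deriv a x) (at x)"
proof -
  have x0: "x \<noteq> 0" and nx: "norm x = 1" using x by auto
  have sgn_x: "sgn x = x" using nx by (simp add: sgn_div_norm)
  have "(sgn has_derivative (\<lambda>h. h - (x \<bullet> h) *\<^sub>R x)) (at x)"
    using has_derivative_sgn[OF x0] nx by (simp add: sgn_x)
  from has_derivative_diff[OF has_derivative_const has_derivative_scaleR[OF height_has_derivative[OF x] this]]
  show ?thesis
    unfolding height_grad_def[of a "sgn _"]
    by (rule has_derivative_eq_rhs) (simp add: height_grad_deriv_def sgn_x fun_eq_iff algebra_simps)
qed

text \<open>The Euler--Lagrange expression of the energy along a height gradient, as a polynomial in
  \<open>c = |a|\<^sup>2\<close> and \<open>r = (a \<bullet> x)\<^sup>2\<close>.\<close>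

definition height_EL :: "real \<Rightarrow> real \<Rightarrow> real \<Rightarrow> real \<Rightarrow> real \<Rightarrow> real" where
  "height_EL p q n c r = - p * r * (n + q * (c - r)) + (2 * p * r + (1 + c - r)) * (1 + q * (c - r))
     - n * q * r * (1 + c - r)"

text \<open>The derivative at \<open>x\<close>, in the direction \<open>h\<close>, of the tangent field \<open>u powr (-p) * l * (w + q (v \<bullet> w) v)\<close>
  for a field \<open>w\<close> with value \<open>w\<close> and derivative \<open>D'\<close> at \<open>x\<close>.\<close>

definition compensator_deriv ::
    "real \<Rightarrow> real \<Rightarrow> 'a::euclidean_space \<Rightarrow> 'a \<Rightarrow> 'a \<Rightarrow> ('a \<Rightarrow> 'a) \<Rightarrow> 'a \<Rightarrow> 'a" where
  "compensator_deriv p q a x w D' h = (let v = height_grad a x; u = 1 + v \<bullet> v; D = height_grad_deriv a x in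
     ((2 * p * (a \<bullet> x)\<^sup>2 * u powr (- p - 1) + u powr (- p)) * (v \<bullet> h)) *\<^sub>R (w + (q * (v \<bullet> w)) *\<^sub>R v) +
     (u powr (- p) * (a \<bullet> x)) *\<^sub>R (D' h + (q * (D h \<bullet> w + v \<bullet> D' h)) *\<^sub>R v + (q * (v \<bullet> w)) *\<^sub>R D h))"

text \<open>\<open>D'\<close> occurs in the varied density only through its trace \<open>T\<close>
  and through \<open>R\<close>, with coefficients \<open>- 2 * u0 * l\<close> and
  \<open>- 2 * q * u0 * l\<close>. The trace of the compensator contributes \<open>u0 * l\<close>
  and \<open>q * u0 * l\<close>, so doubling it cancels both and leaves a multiple of
  \<open>v \<bullet> w\<close>.\<close>

lemma height_variation_identity:
  fixes a x w :: "'a::euclidean_space"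
  assumes x: "x \<in> sphere 0 1" and w: "x \<bullet> w = 0" and D': "linear D'" "D' x = 0"
  defines "v \<equiv> height_grad a x"
  shows "energy_density_variation p q x v w (height_grad_deriv a x) D' +
    2 * (\<Sum>b\<in>Basis. compensator_deriv p q a x w D' b \<bullet> b) =
    2 * ((1 + v \<bullet> v) powr (- p - 1) * height_EL p q (real DIM('a) - 1) (a \<bullet> a) ((a \<bullet> x)\<^sup>2) * (v \<bullet> w))"
proof -
  define l where "l = a \<bullet> x"
  define D where "D = height_grad_deriv a x"
  define T where "T = (\<Sum>b\<in>Basis. b \<bullet> D' b)"
  define R where "R = v \<bullet> D' v"
  define m where "m = v \<bullet> v"
  define u0 where "u0 = (1 + m) powr (- p)"
  define u1 where "u1 = (1 + m) powr (- p - 1)"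
  define N where "N = real DIM('a)"
  have xx: "x \<bullet> x = 1" using x by (simp add: dot_square_norm)
  have vx: "v \<bullet> x = 0" "x \<bullet> v = 0"
    using xx by (simp_all add: v_def height_grad_def inner_diff_left inner_diff_right inner_commute)
  have m: "m = a \<bullet> a - l\<^sup>2"
    using xx by (simp add: m_def v_def height_grad_def l_def inner_diff_left inner_diff_right inner_commute power2_eq_square)
  have "1 + m > 0" by (simp add: m_def add_pos_nonneg)
  \<comment> \<open>Reduces both powers of \<open>1 + m\<close> to \<open>u1\<close>, after which
    the identity is polynomial.\<close>
  then have u0: "u0 = (1 + m) * u1"
    using powr_add[of "1 + m" 1 "- p - 1"] by (simp add: u0_def u1_def)
  have D: "D h = - (v \<bullet> h) *\<^sub>R x - l *\<^sub>R (h - (x \<bullet> h) *\<^sub>R x)" for h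
    by (simp add: D_def height_grad_deriv_def v_def l_def)
  have Dx: "D h \<bullet> x = - (v \<bullet> h)" for h
    using xx by (simp add: D inner_diff_left inner_commute[of h x])
  have Dv: "v \<bullet> D h = - l * (v \<bullet> h)" for h
    using vx by (simp add: D inner_diff_right)
  have Dw: "w \<bullet> D h = - l * (w \<bullet> h)" "D h \<bullet> w = - l * (w \<bullet> h)" for h
    using w by (simp_all add: D inner_diff_right inner_diff_left inner_commute)
  have DD: "D b \<bullet> D b = (v \<bullet> b)\<^sup>2 + l\<^sup>2 * (1 - (x \<bullet> b)\<^sup>2)" if "b \<in> Basis" for b
    using xx that by (simp add: D inner_diff_left inner_diff_right inner_commute power2_eq_square algebra_simps)
  have Db: "D b \<bullet> b = - (v \<bullet> b) * (x \<bullet> b) - l * (1 - (x \<bullet> b)\<^sup>2)" if "b \<in> Basis" for b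
    using that by (simp add: D inner_diff_left power2_eq_square)
  have DD': "D b \<bullet> D' b = - (v \<bullet> b) * (x \<bullet> D' b) - l * (b \<bullet> D' b) + l * ((x \<bullet> b) * (x \<bullet> D' b))" for b
    by (simp add: D inner_diff_left algebra_simps)
  have sums: "(\<Sum>b\<in>Basis. (v \<bullet> b)\<^sup>2) = m" "(\<Sum>b\<in>Basis. (x \<bullet> b)\<^sup>2) = 1"
    "(\<Sum>b\<in>Basis. (v \<bullet> b) * (w \<bullet> b)) = v \<bullet> w" "(\<Sum>b\<in>Basis. (v \<bullet> b) * (x \<bullet> b)) = 0"
    "(\<Sum>b\<in>Basis. (v \<bullet> b) * (v \<bullet> D' b)) = R" "(\<Sum>b\<in>Basis. (x \<bullet> b) * (x \<bullet> D' b)) = 0"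
    using euclidean_inner[of v v] euclidean_inner[of x x] euclidean_inner[of v w] euclidean_inner[of v x]
      xx vx sum_inner_linear[OF D'(1), of v v] sum_inner_linear[OF D'(1), of x x] D'(2)
    by (simp_all add: m_def R_def power2_eq_square)
  \<comment> \<open>\<open>N - 1\<close> is the trace of the projection to the tangent space, that
    is, the dimension of the sphere.\<close>
  have S1: "(\<Sum>b\<in>Basis. D b \<bullet> D b - (D b \<bullet> x)\<^sup>2 + q * (v \<bullet> D b)\<^sup>2) = (N - 1) * l\<^sup>2 + q * l\<^sup>2 * m"
  proof -
    have "(\<Sum>b\<in>Basis. D b \<bullet> D b - (D b \<bullet> x)\<^sup>2 + q * (v \<bullet> D b)\<^sup>2) =
        (\<Sum>b\<in>(Basis::'a set). l\<^sup>2 - l\<^sup>2 * (x \<bullet> b)\<^sup>2 + q * l\<^sup>2 * (v \<bullet> b)\<^sup>2)"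
      by (intro sum.cong refl) (simp add: DD Dx Dv power_mult_distrib algebra_simps)
    also have "\<dots> = (N - 1) * l\<^sup>2 + q * l\<^sup>2 * m"
      by (simp add: sum.distrib sum_subtractf sums flip: sum_distrib_left) (simp add: N_def algebra_simps)
    finally show ?thesis .
  qed
  \<comment> \<open>The normal term \<open>- (v \<bullet> b) * (x \<bullet> D' b)\<close> of
    \<open>DD'\<close> is cancelled by the product of \<open>D b \<bullet> x\<close> and
    \<open>D' b \<bullet> x\<close>.\<close>
  have S2: "(\<Sum>b\<in>Basis. 2 * (D b \<bullet> D' b) - 2 * (D b \<bullet> x) * (D' b \<bullet> x) +
      q * (2 * (v \<bullet> D b) * (w \<bullet> D b + v \<bullet> D' b))) = - 2 * l * T + 2 * q * (l\<^sup>2 * (v \<bullet> w) - l * R)"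
  proof -
    have "(\<Sum>b\<in>Basis. 2 * (D b \<bullet> D' b) - 2 * (D b \<bullet> x) * (D' b \<bullet> x) +
        q * (2 * (v \<bullet> D b) * (w \<bullet> D b + v \<bullet> D' b))) =
        (\<Sum>b\<in>Basis. (- 2 * l) * (b \<bullet> D' b) + 2 * l * ((x \<bullet> b) * (x \<bullet> D' b))
          + 2 * q * l\<^sup>2 * ((v \<bullet> b) * (w \<bullet> b)) - 2 * q * l * ((v \<bullet> b) * (v \<bullet> D' b)))"
      by (intro sum.cong refl) (simp add: DD' Dx Dv Dw inner_commute[of "D' _" x] power2_eq_square algebra_simps)
    also have "\<dots> = - 2 * l * T + 2 * q * (l\<^sup>2 * (v \<bullet> w) - l * R)"
      unfolding sum.distrib sum_subtractf sum_distrib_left[symmetric] sums T_def[symmetric]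
      by (simp add: algebra_simps)
    finally show ?thesis .
  qed
  \<comment> \<open>The first line comes from differentiating \<open>u powr (- p) * l\<close>, where
    \<open>u\<close> has derivative \<open>- 2 * l * (v \<bullet> h)\<close>. The term with
    \<open>N - 1\<close> is the divergence of \<open>v\<close>, which is
    \<open>- (N - 1) * l\<close>.\<close>
  have S3: "(\<Sum>b\<in>Basis. compensator_deriv p q a x w D' b \<bullet> b) =
      (2 * p * l\<^sup>2 * u1 + u0) * (v \<bullet> w) * (1 + q * m) +
      u0 * l * (T + q * (- l * (v \<bullet> w) + R - (N - 1) * l * (v \<bullet> w)))"
  proof -
    let ?k = "2 * p * l\<^sup>2 * u1 + u0"
    have "(\<Sum>b\<in>Basis. compensator_deriv p q a x w D' b \<bullet> b) =
      (\<Sum>b\<in>Basis. ?k * ((v \<bullet> b) * (w \<bullet> b)) + ?k * q * (v \<bullet> w) * (v \<bullet> b)\<^sup>2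
        + u0 * l * (b \<bullet> D' b) - u0 * l * q * l * ((v \<bullet> b) * (w \<bullet> b)) + u0 * l * q * ((v \<bullet> b) * (v \<bullet> D' b))
        - u0 * l * q * (v \<bullet> w) * ((v \<bullet> b) * (x \<bullet> b)) - u0 * l * q * (v \<bullet> w) * l
        + u0 * l * q * (v \<bullet> w) * l * (x \<bullet> b)\<^sup>2)"
    proof (intro sum.cong refl)
      fix b :: 'a assume b: "b \<in> Basis"
      have "compensator_deriv p q a x w D' b \<bullet> b = ?k * (v \<bullet> b) * (w \<bullet> b + q * (v \<bullet> w) * (v \<bullet> b)) +
        u0 * l * (b \<bullet> D' b + q * (D b \<bullet> w + v \<bullet> D' b) * (v \<bullet> b) + q * (v \<bullet> w) * (D b \<bullet> b))"
        unfolding compensator_deriv_def Let_def v_def[symmetric] D_def[symmetric] l_def[symmetric]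
          m_def[symmetric] u0_def[symmetric] u1_def[symmetric]
        by (simp add: inner_add_left inner_commute[of "D' b" b])
      then show "compensator_deriv p q a x w D' b \<bullet> b = ?k * ((v \<bullet> b) * (w \<bullet> b)) + ?k * q * (v \<bullet> w) * (v \<bullet> b)\<^sup>2
        + u0 * l * (b \<bullet> D' b) - u0 * l * q * l * ((v \<bullet> b) * (w \<bullet> b)) + u0 * l * q * ((v \<bullet> b) * (v \<bullet> D' b))
        - u0 * l * q * (v \<bullet> w) * ((v \<bullet> b) * (x \<bullet> b)) - u0 * l * q * (v \<bullet> w) * l
        + u0 * l * q * (v \<bullet> w) * l * (x \<bullet> b)\<^sup>2"
        unfolding Dw Db[OF b] power2_eq_square by (simp add: algebra_simps)
    qed
    also have "\<dots> = (2 * p * l\<^sup>2 * u1 + u0) * (v \<bullet> w) * (1 + q * m) +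
      u0 * l * (T + q * (- l * (v \<bullet> w) + R - (N - 1) * l * (v \<bullet> w)))"
      unfolding sum.distrib sum_subtractf sum_distrib_left[symmetric] sums T_def[symmetric] sum_constant
        N_def[symmetric]
      by (simp add: algebra_simps)
    finally show ?thesis .
  qed
  have eq: "energy_density_variation p q x v w D D' =
      - p * u1 * (2 * (v \<bullet> w)) * ((N - 1) * l\<^sup>2 + q * l\<^sup>2 * m) + u0 * (- 2 * l * T + 2 * q * (l\<^sup>2 * (v \<bullet> w) - l * R))"
    unfolding energy_density_variation_def S1 S2 by (simp add: u0_def u1_def m_def)
  have aa: "a \<bullet> a = m + l\<^sup>2" using m by simp
  show ?thesis
    unfolding S3 D_def[symmetric] m_def[symmetric] l_def[symmetric] N_def[symmetric] u1_def[symmetric]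
      eq height_EL_def aa u0
    by (simp add: power2_eq_square algebra_simps)
qed

text \<open>Integrating the pointwise identity over the sphere removes the compensator by the
  divergence theorem; the factor 2 of the identity meets the factor 1/2 of the energy.\<close>

theorem height_grad_first_variation:
  fixes s :: "real \<Rightarrow> 'a::euclidean_space \<Rightarrow> 'a"
  defines "V \<equiv> \<lambda>x. vector_derivative (\<lambda>\<tau>. s \<tau> x) (at 0)"
  assumes s: "smooth_variation \<sigma> \<epsilon> s" and \<sigma>: "\<And>x. x \<in> sphere 0 1 \<Longrightarrow> \<sigma> x = height_grad a x"
  shows "((\<lambda>t. vertical_energy p q (s t)) has_real_derivative
    (\<integral>x. (1 + height_grad a x \<bullet> height_grad a x) powr (- p - 1) *
       height_EL p q (real DIM('a) - 1) (a \<bullet> a) ((a \<bullet> x)\<^sup>2) * (height_grad a x \<bullet> V x) \<partial>sphere_vol)) (at 0)"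
proof -
  let ?I = "{-\<epsilon><..<\<epsilon>}" and ?S = "sphere (0::'a) 1"
  have \<epsilon>: "\<epsilon> > 0" and smooth: "smooth_map_on (?I \<times> ?S) (\<lambda>(t, x). s t x)"
    and tan: "\<And>t x. t \<in> ?I \<Longrightarrow> x \<in> ?S \<Longrightarrow> s t x \<in> tangent_space x"
    and s0: "\<And>x. x \<in> ?S \<Longrightarrow> s 0 x = height_grad a x"
    using s \<sigma> by (auto simp: smooth_variation_def)
  have I: "open ?I" and I0: "0 \<in> ?I" using \<epsilon> by auto
  have Vt: "smooth_map_on (?I \<times> ?S) (\<lambda>(t, x). vector_derivative (\<lambda>\<tau>. s \<tau> x) (at t))"
    by (rule smooth_time_derivative[OF I smooth])
  define D' where "D' = sphere_deriv V"
  have D': "((\<lambda>y. V (sgn y)) has_derivative D' x) (at x)" if "x \<in> ?S" for x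
    using has_space_derivative[OF I Vt, of 0 x] that I0 by (simp add: D'_def V_def)
  have contD': "continuous_on ?S (\<lambda>x. D' x h)" for h
    unfolding D'_def V_def
    by (rule continuous_on_compose2[OF continuous_on_space_derivative[OF I Vt, unfolded case_prod_beta], of ?S "Pair 0", simplified])
      (use \<epsilon> in \<open>auto intro!: continuous_intros\<close>)
  have contV: "continuous_on ?S V"
    unfolding V_def
    by (rule continuous_on_compose2[OF smooth_map_on_imp_continuous_on[OF Vt, unfolded case_prod_beta], of ?S "Pair 0", simplified])
      (use \<epsilon> in \<open>auto intro!: continuous_intros\<close>)
  \<comment> \<open>For fixed \<open>x\<close> tangency is a linear condition on
    \<open>s t x\<close>, so it passes to the velocity; this is what makes the compensating field
    tangent.\<close>
  have tanV: "x \<bullet> V x = 0" if x: "x \<in> ?S" for x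
  proof -
    have "((\<lambda>\<tau>. s \<tau> x \<bullet> x) has_real_derivative V x \<bullet> x) (at 0)"
      using has_real_derivative_inner[OF has_time_derivative[OF I smooth] has_vector_derivative_const, of 0 x x] x I0
      by (simp add: V_def)
    moreover have "((\<lambda>\<tau>. s \<tau> x \<bullet> x) has_real_derivative 0) (at 0)"
      by (rule has_field_derivative_transform_within_open[OF DERIV_const I I0])
        (use tan x in \<open>auto simp: tangent_space_def inner_commute\<close>)
    ultimately show ?thesis using DERIV_unique by (fastforce simp: inner_commute)
  qed
  have D0: "sphere_deriv (s 0) x = height_grad_deriv a x" if x: "x \<in> ?S" for x
  proof (rule sphere_deriv_eq)
    have x0: "x \<noteq> 0" using x by auto
    show "((\<lambda>y. s 0 (sgn y)) has_derivative height_grad_deriv a x) (at x)"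
      by (rule has_derivative_transform_within_open[OF height_grad_has_derivative[OF x], of "-{0}"])
        (use x0 s0 in \<open>auto simp: norm_sgn\<close>)
  qed
  define W where "W = (\<lambda>y. ((1 + height_grad a y \<bullet> height_grad a y) powr (- p) * (a \<bullet> y)) *\<^sub>R
    (V y + (q * (height_grad a y \<bullet> V y)) *\<^sub>R height_grad a y))"
  define W' where "W' = (\<lambda>x. compensator_deriv p q a x (V x) (D' x))"
  have derW: "((\<lambda>y. W (sgn y)) has_derivative W' x) (at x)" if x: "x \<in> ?S" for x
  proof -
    let ?v = "height_grad a x" and ?D = "height_grad_deriv a x"
    have sgn_x: "sgn x = x" using x by (simp add: sgn_div_norm)
    have vx: "?v \<bullet> x = 0"
      using x by (simp add: height_grad_def inner_diff_left dot_square_norm)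
    have vD: "?v \<bullet> ?D h = - (a \<bullet> x) * (?v \<bullet> h)" for h
      using vx by (simp add: height_grad_deriv_def inner_diff_right)
    note v = height_grad_has_derivative[OF x, of a]
    note l = height_has_derivative[OF x, of a]
    have pos: "1 + ?v \<bullet> ?v > 0" by (simp add: add_pos_nonneg)
    have "((\<lambda>y. 1 + height_grad a (sgn y) \<bullet> height_grad a (sgn y)) has_derivative
        (\<lambda>h. 0 + (height_grad a (sgn x) \<bullet> ?D h + ?D h \<bullet> height_grad a (sgn x)))) (at x)"
      by (intro has_derivative_add has_derivative_const has_derivative_inner v)
    then have u: "((\<lambda>y. 1 + height_grad a (sgn y) \<bullet> height_grad a (sgn y)) has_derivative
        (\<lambda>h. - 2 * (a \<bullet> x) * (?v \<bullet> h))) (at x)"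
      by (rule has_derivative_eq_rhs) (simp add: fun_eq_iff sgn_x vD inner_commute[of "?D _"])
    have "((\<lambda>y. (1 + height_grad a (sgn y) \<bullet> height_grad a (sgn y)) powr (- p)) has_derivative
        (\<lambda>h. - p * (1 + ?v \<bullet> ?v) powr (- p - 1) * (- 2 * (a \<bullet> x) * (?v \<bullet> h)))) (at x)"
    proof (rule has_derivative_compose[OF u, where g = "\<lambda>z. z powr (- p)"])
      show "((\<lambda>z. z powr (- p)) has_derivative (\<lambda>h. - p * (1 + ?v \<bullet> ?v) powr (- p - 1) * h))
          (at (1 + height_grad a (sgn x) \<bullet> height_grad a (sgn x)))"
        using has_real_derivative_powr[OF pos, of "- p"]
        unfolding sgn_x by (rule has_field_derivative_imp_has_derivative)
    qed
    note u' = this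
    have "((\<lambda>y. W (sgn y)) has_derivative (\<lambda>h.
        ((1 + ?v \<bullet> ?v) powr (- p) * (a \<bullet> x)) *\<^sub>R
          (D' x h + ((q * (?v \<bullet> V x)) *\<^sub>R ?D h + (q * (?v \<bullet> D' x h + ?D h \<bullet> V x)) *\<^sub>R ?v)) +
        ((1 + ?v \<bullet> ?v) powr (- p) * (?v \<bullet> h) +
         - p * (1 + ?v \<bullet> ?v) powr (- p - 1) * (- 2 * (a \<bullet> x) * (?v \<bullet> h)) * (a \<bullet> x)) *\<^sub>R
          (V x + (q * (?v \<bullet> V x)) *\<^sub>R ?v))) (at x)"
      using has_derivative_scaleR[OF has_derivative_mult[OF u' l]
        has_derivative_add[OF D'[OF x] has_derivative_scaleR[OF has_derivative_mult_right[OF has_derivative_inner[OF v D'[OF x]]] v]]]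
      unfolding W_def sgn_x .
    then show ?thesis
      unfolding W'_def compensator_deriv_def Let_def
      by (rule has_derivative_eq_rhs) (simp add: fun_eq_iff power2_eq_square algebra_simps)
  qed
  have pos: "1 + v \<bullet> v \<noteq> 0" for v :: 'a
    by (metis add_pos_nonneg inner_ge_zero less_irrefl zero_less_one)
  have contv: "continuous_on ?S (height_grad a)" "continuous_on ?S (\<lambda>x. height_grad_deriv a x h)" for h
    unfolding height_grad_def[abs_def] height_grad_deriv_def by (intro continuous_intros)+
  have contW': "continuous_on ?S (\<lambda>x. W' x h)" for h
    unfolding W'_def compensator_deriv_def Let_def using pos
    by (auto intro!: continuous_intros contV contD' contv)
  have tanW: "W x \<in> tangent_space x" if x: "x \<in> ?S" for x
    using x tanV[OF x]
    by (simp add: W_def tangent_space_def inner_add_right height_grad_def inner_diff_right inner_commute dot_square_norm)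
  have div: "(\<integral>x. (\<Sum>b\<in>Basis. W' x b \<bullet> b) \<partial>sphere_vol) = 0"
    using derW contW' tanW by (rule sphere_divergence)
  let ?G = "\<lambda>x. (1 + height_grad a x \<bullet> height_grad a x) powr (- p - 1) *
    height_EL p q (real DIM('a) - 1) (a \<bullet> a) ((a \<bullet> x)\<^sup>2) * (height_grad a x \<bullet> V x)"
  let ?e = "\<lambda>x. energy_density_variation p q x (s 0 x) (V x) (sphere_deriv (s 0) x) (D' x)"
  have e: "?e x = 2 * ?G x - 2 * (\<Sum>b\<in>Basis. W' x b \<bullet> b)" if x: "x \<in> ?S" for x
    using height_variation_identity[OF x tanV[OF x] has_derivative_linear[OF D'[OF x]]
        has_derivative_sgn_radial[OF D'[OF x] x], of p q a]
    by (simp add: s0[OF x] D0[OF x] W'_def)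
  have contG: "continuous_on ?S ?G"
    unfolding height_EL_def using pos by (auto intro!: continuous_intros contv contV)
  have "(\<integral>x. ?e x \<partial>sphere_vol) = (\<integral>x. 2 * ?G x - 2 * (\<Sum>b\<in>Basis. W' x b \<bullet> b) \<partial>sphere_vol)"
    by (intro Bochner_Integration.integral_cong) (auto simp: e)
  also have "\<dots> = (\<integral>x. 2 * ?G x \<partial>sphere_vol) - (\<integral>x. 2 * (\<Sum>b\<in>Basis. W' x b \<bullet> b) \<partial>sphere_vol)"
    by (intro Bochner_Integration.integral_diff integrable_sphere_vol continuous_intros contG contW')
  also have "\<dots> = 2 * (\<integral>x. ?G x \<partial>sphere_vol)"
    using div by simp
  finally have "1/2 * (\<integral>x. ?e x \<partial>sphere_vol) = (\<integral>x. ?G x \<partial>sphere_vol)" by simp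
  moreover have "((\<lambda>t. vertical_energy p q (s t)) has_real_derivative 1/2 * (\<integral>x. ?e x \<partial>sphere_vol)) (at 0)"
    using first_variation[OF \<epsilon> smooth] by (simp add: V_def D'_def)
  ultimately show ?thesis by simp
qed

section \<open>Smoothness of polynomial maps\<close>

lemma Ck_on_SucD: "Ck_on (Suc k) f U \<Longrightarrow> Ck_on k f U"
proof (induction k arbitrary: f)
  case 0
  then show ?case
    by (auto intro!: continuous_at_imp_continuous_on differentiable_imp_continuous_within)
next
  case (Suc k)
  then have "\<forall>x\<in>U. f differentiable (at x)" "\<And>v. Ck_on (Suc k) (\<lambda>x. frechet_derivative f (at x) v) U"
    by simp_all
  with Suc.IH show ?case by simp
qed

lemma Ck_on_SucI:
  assumes "\<And>x. (f has_derivative f' x) (at x)" "\<And>v. Ck_on k (\<lambda>x. f' x v) UNIV"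
  shows "Ck_on (Suc k) f UNIV"
proof -
  have "frechet_derivative f (at x) = f' x" for x
    using assms(1) frechet_derivative_at by metis
  with assms show ?thesis by (auto simp: differentiable_def)
qed

lemma Ck_on_const: "Ck_on k (\<lambda>_. c) UNIV"
proof (induction k arbitrary: c)
  case (Suc k)
  show ?case by (rule Ck_on_SucI[OF has_derivative_const Suc])
qed simp

lemma Ck_on_bounded_linear:
  assumes "bounded_linear f"
  shows "Ck_on k f UNIV"
proof (cases k)
  case 0
  then show ?thesis using assms by (simp add: linear_continuous_on)
next
  case (Suc m)
  show ?thesis
    unfolding Suc by (rule Ck_on_SucI[OF bounded_linear_imp_has_derivative[OF assms] Ck_on_const])
qed

lemma Ck_on_add:
  assumes "Ck_on k f UNIV" "Ck_on k g UNIV"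
  shows "Ck_on k (\<lambda>x. f x + g x) UNIV"
  using assms
proof (induction k arbitrary: f g)
  case (Suc k)
  show ?case
  proof (rule Ck_on_SucI)
    show "((\<lambda>x. f x + g x) has_derivative
        (\<lambda>h. frechet_derivative f (at x) h + frechet_derivative g (at x) h)) (at x)" for x
      using Suc.prems by (intro has_derivative_add Ck_on_Suc_has_derivative) auto
    show "Ck_on k (\<lambda>x. frechet_derivative f (at x) v + frechet_derivative g (at x) v) UNIV" for v
      using Suc.prems by (intro Suc.IH) auto
  qed
qed (simp add: continuous_on_add)

text \<open>In the Leibniz rule one factor stays undifferentiated; \<open>Ck_on_SucD\<close> lowers
  it to the order at which the induction hypothesis applies.\<close>

lemma Ck_on_scaleR:
  assumes "Ck_on k f UNIV" "Ck_on k g UNIV"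
  shows "Ck_on k (\<lambda>x. f x *\<^sub>R g x) UNIV"
  using assms
proof (induction k arbitrary: f g)
  case (Suc k)
  show ?case
  proof (rule Ck_on_SucI)
    show "((\<lambda>x. f x *\<^sub>R g x) has_derivative
        (\<lambda>h. f x *\<^sub>R frechet_derivative g (at x) h + frechet_derivative f (at x) h *\<^sub>R g x)) (at x)" for x
      using Suc.prems by (intro has_derivative_scaleR Ck_on_Suc_has_derivative) auto
    show "Ck_on k (\<lambda>x. f x *\<^sub>R frechet_derivative g (at x) v + frechet_derivative f (at x) v *\<^sub>R g x) UNIV" for v
      using Suc.prems Suc.prems[THEN Ck_on_SucD] by (intro Ck_on_add Suc.IH) auto
  qed
qed (simp add: continuous_on_scaleR)

lemma Ck_on_mult:
  fixes f g :: "'a::euclidean_space \<Rightarrow> real"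
  shows "Ck_on k f UNIV \<Longrightarrow> Ck_on k g UNIV \<Longrightarrow> Ck_on k (\<lambda>x. f x * g x) UNIV"
  unfolding real_scaleR_def[symmetric] by (rule Ck_on_scaleR)

lemma Ck_on_diff:
  assumes "Ck_on k f UNIV" "Ck_on k g UNIV"
  shows "Ck_on k (\<lambda>x. f x - g x) UNIV"
  using Ck_on_add[OF assms(1) Ck_on_scaleR[OF Ck_on_const[of k "-1"] assms(2)]] by simp

lemma smooth_map_onI:
  assumes "\<And>k. Ck_on k f UNIV"
  shows "smooth_map_on A f"
  using assms unfolding smooth_map_on_def by (intro ballI exI[of _ UNIV] exI[of _ f]) simp

lemma Ck_on_height_grad:
  assumes "bounded_linear f"
  shows "Ck_on k (\<lambda>z. height_grad a (f z)) UNIV"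
  unfolding height_grad_def
  by (rule Ck_on_diff[OF Ck_on_const Ck_on_scaleR[OF
        Ck_on_bounded_linear[OF bounded_linear_compose[OF bounded_linear_inner_right assms]]
        Ck_on_bounded_linear[OF assms]]])

section \<open>Values of the height function and harmonicity\<close>

lemma inner_height_grad:
  assumes "x \<in> sphere 0 1"
  shows "x \<bullet> height_grad a x = 0" and "height_grad a x \<bullet> height_grad a x = a \<bullet> a - (a \<bullet> x)\<^sup>2"
proof -
  have "x \<bullet> x = 1" using assms by (simp add: dot_square_norm)
  then show "x \<bullet> height_grad a x = 0" "height_grad a x \<bullet> height_grad a x = a \<bullet> a - (a \<bullet> x)\<^sup>2"
    by (simp_all add: height_grad_def inner_diff_right inner_diff_left inner_commute[of x a] power2_eq_square)
qed

text \<open>The point is sought on the great circle through the direction of \<open>a\<close> and an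
  orthogonal unit vector \<open>b\<close>, whose existence uses dimension at least 2.\<close>

lemma exists_height:
  fixes a :: "'a::euclidean_space"
  assumes "DIM('a) \<ge> 2" "a \<noteq> 0" "0 \<le> r" "r \<le> a \<bullet> a"
  shows "\<exists>x\<in>sphere 0 1. (a \<bullet> x)\<^sup>2 = r"
proof -
  obtain b0 where b0: "b0 \<noteq> 0" "a \<bullet> b0 = 0"
    using orthogonal_to_vector_exists[OF assms(1), of a] by (auto simp: orthogonal_def)
  define b where "b = b0 /\<^sub>R norm b0"
  have b: "a \<bullet> b = 0" "b \<bullet> b = 1"
    using b0 by (simp_all add: b_def dot_square_norm power2_eq_square)
  define c where "c = a \<bullet> a"
  have c: "c > 0" using assms(2) by (simp add: c_def)
  \<comment> \<open>The first coefficient gives \<open>a \<bullet> x = sqrt r\<close> and uses up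
    \<open>r / c\<close> of the squared length; the second supplies the remainder.\<close>
  define x where "x = (sqrt r / c) *\<^sub>R a + sqrt (1 - r / c) *\<^sub>R b"
  have "a \<bullet> x = sqrt r"
    using b c by (simp add: x_def inner_add_right flip: c_def)
  moreover have "x \<bullet> x = 1"
  proof -
    have "x \<bullet> x = (sqrt r / c)\<^sup>2 * c + (sqrt (1 - r / c))\<^sup>2"
      using b by (simp add: x_def inner_add_right inner_add_left inner_commute[of b a] power2_eq_square flip: c_def)
    also have "\<dots> = r / c + (1 - r / c)"
      using assms(3,4) c by (simp add: power_divide power2_eq_square[of c] flip: c_def)
    finally show ?thesis by simp
  qed
  ultimately show ?thesis
    using assms(3) by (intro bexI[of _ x]) (simp_all add: norm_eq_1)
qed

text \<open>For the chosen variation the integrand of the first variation is nonnegative, so a zero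
  integral makes it vanish pointwise. Dividing by
  \<open>height_grad a x \<bullet> height_grad a x\<close> is what excludes the two poles.\<close>

lemma harmonic_imp_height_EL_eq_0:
  fixes \<sigma> :: "'a::euclidean_space \<Rightarrow> 'a"
  assumes \<sigma>: "\<And>x. x \<in> sphere 0 1 \<Longrightarrow> \<sigma> x = height_grad a x" and h: "harmonic_section p q \<sigma>"
    and x: "x \<in> sphere 0 1" "(a \<bullet> x)\<^sup>2 \<noteq> a \<bullet> a"
  shows "height_EL p q (real DIM('a) - 1) (a \<bullet> a) ((a \<bullet> x)\<^sup>2) = 0"
proof -
  let ?S = "sphere (0::'a) 1"
  define \<psi> where "\<psi> = (\<lambda>x. height_EL p q (real DIM('a) - 1) (a \<bullet> a) ((a \<bullet> x)\<^sup>2))"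
  \<comment> \<open>As \<open>\<psi>\<close> is a polynomial in \<open>x\<close>, \<open>s\<close>
    is smooth on the whole product space and serves as its own extension; it is tangent for every
    \<open>t\<close>, so the time range 1 used below is arbitrary.\<close>
  define s where "s = (\<lambda>t x. height_grad a x + (t * \<psi> x) *\<^sub>R height_grad a x)"
  have "Ck_on k (\<lambda>z::real \<times> 'a. s (fst z) (snd z)) UNIV" for k
  proof -
    have l: "Ck_on k (\<lambda>z::real \<times> 'a. a \<bullet> snd z) UNIV"
      by (intro Ck_on_bounded_linear bounded_linear_compose[OF bounded_linear_inner_right bounded_linear_snd])
    show ?thesis
      unfolding s_def \<psi>_def height_EL_def power2_eq_square
      by (intro Ck_on_add Ck_on_scaleR Ck_on_mult Ck_on_diff Ck_on_const l
          Ck_on_height_grad[OF bounded_linear_snd] Ck_on_bounded_linear[OF bounded_linear_fst])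
  qed
  then have smooth: "smooth_map_on A (\<lambda>(t, x). s t x)" for A
    unfolding case_prod_beta by (rule smooth_map_onI)
  have var: "smooth_variation \<sigma> 1 s"
    unfolding smooth_variation_def
  proof (intro conjI ballI smooth)
    show "s t x \<in> tangent_space x" if "x \<in> ?S" for t x
      using inner_height_grad(1)[OF that, of a] by (simp add: s_def tangent_space_def inner_add_right)
  qed (use \<sigma> in \<open>auto simp: s_def\<close>)
  have V: "vector_derivative (\<lambda>\<tau>. s \<tau> x) (at 0) = \<psi> x *\<^sub>R height_grad a x" for x
  proof (rule vector_derivative_at)
    have "((\<lambda>\<tau>. \<tau> *\<^sub>R (\<psi> x *\<^sub>R height_grad a x)) has_vector_derivative \<psi> x *\<^sub>R height_grad a x) (at 0)"
      unfolding has_vector_derivative_def by (rule bounded_linear_imp_has_derivative[OF bounded_linear_scaleR_left])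
    from has_vector_derivative_add[OF has_vector_derivative_const this]
    show "((\<lambda>\<tau>. s \<tau> x) has_vector_derivative \<psi> x *\<^sub>R height_grad a x) (at 0)"
      by (simp add: s_def)
  qed
  let ?f = "\<lambda>x. (1 + height_grad a x \<bullet> height_grad a x) powr (- p - 1) * (\<psi> x)\<^sup>2 * (height_grad a x \<bullet> height_grad a x)"
  have "((\<lambda>t. vertical_energy p q (s t)) has_real_derivative 0) (at 0)"
    using h var by (auto simp: harmonic_section_def)
  moreover have "((\<lambda>t. vertical_energy p q (s t)) has_real_derivative (\<integral>x. ?f x \<partial>sphere_vol)) (at 0)"
  proof -
    have "height_EL p q (real DIM('a) - 1) (a \<bullet> a) ((a \<bullet> x)\<^sup>2) = \<psi> x" for x
      by (simp add: \<psi>_def)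
    then show ?thesis
      using height_grad_first_variation[OF var \<sigma>, of p q]
      unfolding V by (simp add: power2_eq_square[of "\<psi> _"] mult.assoc)
  qed
  ultimately have int: "(\<integral>x. ?f x \<partial>sphere_vol) = 0"
    using DERIV_unique by blast
  have pos: "1 + v \<bullet> v > 0" for v :: 'a by (simp add: add_pos_nonneg)
  have "continuous_on ?S (height_grad a)"
    unfolding height_grad_def[abs_def] by (intro continuous_intros)
  then have cont: "continuous_on ?S ?f"
    unfolding \<psi>_def height_EL_def using pos less_imp_neq[OF pos]
    by (intro continuous_intros) (auto dest: sym)
  have "?f x = 0"
    by (rule integral_sphere_vol_eq_0[OF cont _ int x(1)]) (simp add: zero_le_mult_iff)
  moreover have "height_grad a x \<bullet> height_grad a x \<noteq> 0"
    using inner_height_grad(2)[OF x(1)] x(2) by simp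
  moreover have "(1 + height_grad a x \<bullet> height_grad a x) powr (- p - 1) \<noteq> 0"
    using pos[of "height_grad a x"] by simp
  ultimately show ?thesis
    unfolding \<psi>_def by (metis mult_eq_0_iff power_eq_0_iff)
qed

lemma harmonic_if_height_EL_eq_0:
  fixes \<sigma> :: "'a::euclidean_space \<Rightarrow> 'a"
  assumes \<sigma>: "\<And>x. x \<in> sphere 0 1 \<Longrightarrow> \<sigma> x = height_grad a x"
    and EL: "\<And>r. height_EL p q (real DIM('a) - 1) (a \<bullet> a) r = 0"
  shows "harmonic_section p q \<sigma>"
  unfolding harmonic_section_def smooth_vector_field_def
proof (intro conjI allI impI ballI)
  have "Ck_on k (height_grad a) UNIV" for k
    using Ck_on_height_grad[OF bounded_linear_ident] .
  then show "smooth_map_on (sphere 0 1) \<sigma>"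
    unfolding smooth_map_on_def using \<sigma> by (intro ballI exI[of _ UNIV] exI[of _ "height_grad a"]) simp
  show "\<sigma> x \<in> tangent_space x" if "x \<in> sphere 0 1" for x
    using \<sigma>[OF that] inner_height_grad(1)[OF that] by (simp add: tangent_space_def)
  show "((\<lambda>t. vertical_energy p q (s t)) has_real_derivative 0) (at 0)" if "smooth_variation \<sigma> \<epsilon> s" for \<epsilon> s
    using height_grad_first_variation[OF that \<sigma>, of p q] by (simp add: EL)
qed

text \<open>The squared norm \<open>a \<bullet> a - (a \<bullet> x)\<^sup>2\<close> is largest on
  the equator \<open>a \<bullet> x = 0\<close>, which is nonempty by
  \<open>exists_height\<close>.\<close>

lemma sup_norm_height_grad:
  fixes \<sigma> :: "'a::euclidean_space \<Rightarrow> 'a"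
  assumes \<sigma>: "\<And>x. x \<in> sphere 0 1 \<Longrightarrow> \<sigma> x = height_grad a x" and "DIM('a) \<ge> 2" "a \<noteq> 0"
  shows "sup_norm \<sigma> = norm a"
  unfolding sup_norm_def
proof (rule cSup_eq_maximum)
  have norm: "norm (\<sigma> x) = sqrt (a \<bullet> a - (a \<bullet> x)\<^sup>2)" if "x \<in> sphere 0 1" for x
    by (simp add: \<sigma>[OF that] norm_eq_sqrt_inner inner_height_grad(2)[OF that])
  obtain x where x: "x \<in> sphere 0 1" "(a \<bullet> x)\<^sup>2 = 0"
    using exists_height[OF assms(2,3), of 0] by auto
  then have "norm (\<sigma> x) = norm a"
    using norm[OF x(1)] by (simp add: norm_eq_sqrt_inner)
  with x show "norm a \<in> (\<lambda>x. norm (\<sigma> x)) ` sphere 0 1"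
    by (metis imageI)
  show "y \<le> norm a" if "y \<in> (\<lambda>x. norm (\<sigma> x)) ` sphere 0 1" for y
    using that norm by (auto simp: norm_eq_sqrt_inner[of a])
qed

section \<open>Solving for the parameters\<close>

lemma height_EL_coefficients:
  "height_EL p q n c r = (1 + c) * (1 + q * c) +
     ((2 - n) * p - 1 + p * q * c - q * (1 + 2 * c) - n * q * (1 + c)) * r + q * (n + 1 - p) * r\<^sup>2"
  by (simp add: height_EL_def power2_eq_square algebra_simps)

text \<open>The constant coefficient forces \<open>q * c = - 1\<close>, hence
  \<open>q \<noteq> 0\<close>; the quadratic one then gives \<open>p = n + 1\<close>, and the linear
  one becomes \<open>(n + 1) * (2 - n - q)\<close>. Part (2) gives vanishing at every
  \<open>r\<close>, also outside \<open>[0, c)\<close>.\<close>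

lemma height_EL_eq_0_iff:
  assumes c: "c > 0" and n: "n > 0"
  shows "(\<forall>r. 0 \<le> r \<and> r < c \<longrightarrow> height_EL p q n c r = 0) \<longleftrightarrow> p = n + 1 \<and> q = 2 - n \<and> q * c = - 1"
    and "p = n + 1 \<Longrightarrow> q = 2 - n \<Longrightarrow> q * c = - 1 \<Longrightarrow> height_EL p q n c r = 0"
proof -
  define e1 where "e1 = (2 - n) * p - 1 + p * q * c - q * (1 + 2 * c) - n * q * (1 + c)"
  define e2 where "e2 = q * (n + 1 - p)"
  have EL: "height_EL p q n c r = (1 + c) * (1 + q * c) + e1 * r + e2 * r\<^sup>2" for r
    unfolding height_EL_coefficients e1_def e2_def ..
  have e1: "e1 = (2 - n) * p - p - 1 - q + 2 - n * q + n" if "q * c = - 1"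
  proof -
    have "e1 = (2 - n) * p - 1 + p * (q * c) - q - 2 * (q * c) - n * q - n * (q * c)"
      by (simp add: e1_def algebra_simps)
    then show ?thesis by (simp add: that)
  qed
  show if_zero: "height_EL p q n c r = 0" if "p = n + 1" "q = 2 - n" "q * c = - 1" for r
  proof -
    have "e1 = 0" using e1[OF that(3)] by (simp add: that(1,2) algebra_simps)
    moreover have "e2 = 0" by (simp add: e2_def that(1))
    ultimately show ?thesis by (simp add: EL that(3))
  qed
  show "(\<forall>r. 0 \<le> r \<and> r < c \<longrightarrow> height_EL p q n c r = 0) \<longleftrightarrow> p = n + 1 \<and> q = 2 - n \<and> q * c = - 1"
  proof
    assume *: "\<forall>r. 0 \<le> r \<and> r < c \<longrightarrow> height_EL p q n c r = 0"
    \<comment> \<open>Three points of \<open>[0, c)\<close> determine a quadratic polynomial: 0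
      isolates the constant term, and the other two give a linear system for \<open>e1\<close> and
      \<open>e2\<close>.\<close>
    then have "height_EL p q n c 0 = 0" "height_EL p q n c (c / 2) = 0" "height_EL p q n c (c / 4) = 0"
      using c by auto
    then have "(1 + c) * (1 + q * c) = 0" "(c / 2) * (e1 + e2 * (c / 2)) = 0" "(c / 4) * (e1 + e2 * (c / 4)) = 0"
      unfolding EL by (simp_all add: power2_eq_square algebra_simps)
    then have "1 + q * c = 0" "e1 + e2 * c / 2 = 0" "e1 + e2 * c / 4 = 0"
      using c by auto
    then have qc: "q * c = - 1" and "e2 * c = 0" "e1 = 0" by linarith+
    then have "e2 = 0" using c by simp
    moreover have "q \<noteq> 0" using qc by auto
    ultimately have p: "p = n + 1" by (simp add: e2_def)
    have "(n + 1) * (2 - n - q) = 0"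
      using e1[OF qc] \<open>e1 = 0\<close> by (simp add: p algebra_simps)
    then have "q = 2 - n" using n by simp
    with p qc show "p = n + 1 \<and> q = 2 - n \<and> q * c = - 1" by simp
  qed (use if_zero in blast)
qed

theorem theorem5p2:
  fixes \<sigma> :: "'a::euclidean_space \<Rightarrow> 'a" and p q :: real and n :: nat
  assumes "DIM('a) = n + 1" and "n \<ge> 1"
    and "conformal_gradient_field \<sigma>"
  shows "harmonic_section p q \<sigma> \<longleftrightarrow>
    n \<ge> 3 \<and> p = real n + 1 \<and> q = 2 - real n \<and> sup_norm \<sigma> = 1 / sqrt (- q)"
proof -
  obtain a where a: "a \<noteq> 0" and \<sigma>: "\<And>x. x \<in> sphere 0 1 \<Longrightarrow> \<sigma> x = height_grad a x"
    using assms(3) by (auto simp: conformal_gradient_field_def sphere_grad_height)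
  define c where "c = a \<bullet> a"
  have c: "c > 0" using a by (simp add: c_def)
  have dim: "DIM('a) \<ge> 2" and n: "real DIM('a) - 1 = real n" and n0: "real n > 0"
    using assms(1,2) by simp_all
  have "harmonic_section p q \<sigma> \<longleftrightarrow> (\<forall>r. 0 \<le> r \<and> r < c \<longrightarrow> height_EL p q n c r = 0)"
  proof
    assume h: "harmonic_section p q \<sigma>"
    show "\<forall>r. 0 \<le> r \<and> r < c \<longrightarrow> height_EL p q n c r = 0"
    proof (intro allI impI)
      fix r assume r: "0 \<le> r \<and> r < c"
      then obtain x where "x \<in> sphere 0 1" "(a \<bullet> x)\<^sup>2 = r"
        using exists_height[OF dim a, of r] by (auto simp: c_def)
      then show "height_EL p q n c r = 0"
        using harmonic_imp_height_EL_eq_0[OF \<sigma> h, of x] r n by (simp add: c_def)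
    qed
  next
    assume "\<forall>r. 0 \<le> r \<and> r < c \<longrightarrow> height_EL p q n c r = 0"
    \<comment> \<open>Passing through the parameter conditions extends the vanishing from
      \<open>[0, c)\<close> to all \<open>r\<close>, which covers the poles, where
      \<open>r = c\<close>.\<close>
    then have "p = real n + 1 \<and> q = 2 - real n \<and> q * c = - 1"
      unfolding height_EL_eq_0_iff(1)[OF c n0] .
    then have "height_EL p q n c r = 0" for r
      using height_EL_eq_0_iff(2)[OF c n0] by blast
    then show "harmonic_section p q \<sigma>"
      by (intro harmonic_if_height_EL_eq_0[OF \<sigma>]) (simp_all add: n c_def)
  qed
  also have "\<dots> \<longleftrightarrow> p = real n + 1 \<and> q = 2 - real n \<and> q * c = - 1"
    by (rule height_EL_eq_0_iff(1)[OF c n0])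
  also have "\<dots> \<longleftrightarrow> n \<ge> 3 \<and> p = real n + 1 \<and> q = 2 - real n \<and> sup_norm \<sigma> = 1 / sqrt (- q)"
  proof -
    \<comment> \<open>Here \<open>c\<close> is the square of \<open>sup_norm \<sigma>\<close>. The
      sign of \<open>q\<close> is carried along so that squaring \<open>sqrt (- q)\<close> returns
      \<open>- q\<close>.\<close>
    have "q * c = - 1 \<longleftrightarrow> q < 0 \<and> sup_norm \<sigma> = 1 / sqrt (- q)"
    proof
      assume qc: "q * c = - 1"
      then have "- q = 1 / c" using c by (simp add: eq_divide_eq)
      moreover from this have "q < 0" using c by (metis neg_0_less_iff_less zero_less_divide_1_iff)
      ultimately have q: "- q = 1 / c" "q < 0" .
      have "1 / sqrt (- q) = sqrt c" by (simp add: q(1) real_sqrt_divide)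
      then show "q < 0 \<and> sup_norm \<sigma> = 1 / sqrt (- q)"
        using q(2) sup_norm_height_grad[OF \<sigma> dim a] by (simp add: c_def norm_eq_sqrt_inner)
    next
      assume q: "q < 0 \<and> sup_norm \<sigma> = 1 / sqrt (- q)"
      then have "sqrt c = 1 / sqrt (- q)"
        using sup_norm_height_grad[OF \<sigma> dim a] by (simp add: c_def norm_eq_sqrt_inner)
      then have "(sqrt c)\<^sup>2 = (1 / sqrt (- q))\<^sup>2" by simp
      then have "c = 1 / - q" using q c by (simp add: power_divide)
      then show "q * c = - 1" using q by simp
    qed
    \<comment> \<open>With \<open>q = 2 - real n\<close> the sign condition says
      \<open>n > 2\<close>, and \<open>n\<close> is a natural number.\<close>
    moreover have "n \<ge> 3 \<longleftrightarrow> 2 - real n < 0" by auto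
    ultimately show ?thesis by auto
  qed
  finally show ?thesis .
qed

end
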